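(* Let $G$ be a countably infinite discrete group acting by homeomorphisms on a compact metric space $X$, and let $K\ge2$. If $X$ admits no essential IT $K$-tuples, then for every $\mu\in\mathcal{M}(X,G)$, $$h_\mu^*(G)\le\log(K-1).$$
   Context: $\mathcal{M}(X,G)$ is the set of $G$-invariant Borel probability measures on $X$. $\mathcal{B}_X^\mu$ is the $\mu$-completion of the Borel $\sigma$-algebra, and $\mathcal{P}_X^\mu$ is the set of finite families $\alpha$ of pairwise disjoint sets in $\mathcal{B}_X^\mu$ whose union has full $\mu$-measure. $H_\mu(\alpha)=-\sum_{A\in\alpha}\mu(A)\log\mu(A)$. For a sequence $\mathcal{A}=\{g_i\}_{i\in\mathbb{N}}$ in $G$, $h_\mu^{\mathcal{A}}(G,\alpha)=\limsup_{n\to\infty}\frac1n H_\mu(\bigvee_{i=1}^n g_i^{-1}\alpha)$; $h_\mu^*(G,\alpha)=\sup_{\mathcal{A}}h_\mu^{\mathcal{A}}(G,\alpha)$ over all sequences in $G$; and $h_\mu^*(G)=\sup_{\alpha\in\mathcal{P}_X^\mu}h_\mu^*(G,\alpha)$. A set $J\subset G$ is an independence set for a tuple $(A_1,\ldots,A_K)$ of subsets of $X$ if for every nonempty finite $I\subset J$ and every $\sigma:I\to\{1,\ldots,K\}$ one has $\bigcap_{g\in I}g^{-1}(A_{\sigma(g)})\ne\emptyset$. A tuple $(x_1,\ldots,x_K)\in X^{(K)}$ ($K$-fold product) is an IT $K$-tuple if for all open neighborhoods $U_k$ of $x_k$ ($1\le k\le K$) there is an infinite independence set for $(U_1,\ldots,U_K)$.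 A $K$-tuple is essential if $x_i\ne x_j$ for all $1\le i<j\le K$. *)

theory Defs
  imports "HOL-Probability.Probability_Measure" "HOL-Algebra.Group_Action"
begin

text \<open>
  An action of a group \<open>G\<close> on the space \<open>'x\<close> is a map \<open>\<phi> :: 'g \<Rightarrow> 'x \<Rightarrow> 'x\<close> with
  \<open>group_action G UNIV \<phi>\<close>; the set written \<open>g\<^sup>-\<^sup>1 A\<close> is the preimage \<open>\<phi> g -` A\<close>.
  A \<open>K\<close>-tuple is a function on \<open>nat\<close> of which only the values on \<open>{1..K}\<close> are ever inspected.
\<close>

definition homeomorphic_action ::
    "('g, 'm) monoid_scheme \<Rightarrow> ('g \<Rightarrow> 'x::topological_space \<Rightarrow> 'x) \<Rightarrow> bool" where
  "homeomorphic_action G \<phi> \<longleftrightarrow>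
     group_action G UNIV \<phi> \<and> (\<forall>g\<in>carrier G. homeomorphic_map euclidean euclidean (\<phi> g))"

definition invariant_measures ::
    "('g, 'm) monoid_scheme \<Rightarrow> ('g \<Rightarrow> 'x::topological_space \<Rightarrow> 'x) \<Rightarrow> 'x measure set" where
  "invariant_measures G \<phi> =
     {\<mu>. prob_space \<mu> \<and> sets \<mu> = sets borel \<and>
         (\<forall>g\<in>carrier G. \<forall>A\<in>sets borel. emeasure \<mu> (\<phi> g -` A) = emeasure \<mu> A)}"

text \<open>
  Families are rendered as sets of sets: by disjointness only the empty set could be repeated
  in a family, and it does not contribute to the entropy.
\<close>

definition measurable_partitions :: "'x measure \<Rightarrow> 'x set set set" where
  "measurable_partitions \<mu> =
     {\<alpha>. finite \<alpha> \<and> \<alpha> \<subseteq> sets (completion \<mu>) \<and> disjoint \<alpha> \<and>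
         measure (completion \<mu>) (\<Union>\<alpha>) = 1}"

definition partition_entropy :: "'x measure \<Rightarrow> 'x set set \<Rightarrow> real" where
  "partition_entropy \<mu> \<alpha> =
     - (\<Sum>A\<in>\<alpha>. measure (completion \<mu>) A * ln (measure (completion \<mu>) A))"

text \<open>The join of \<open>s(1)\<^sup>-\<^sup>1 \<alpha>, \<dots>, s(n)\<^sup>-\<^sup>1 \<alpha>\<close>; the value \<open>s 0\<close> is not used.\<close>

definition pullback_join ::
    "('g \<Rightarrow> 'x \<Rightarrow> 'x) \<Rightarrow> (nat \<Rightarrow> 'g) \<Rightarrow> 'x set set \<Rightarrow> nat \<Rightarrow> 'x set set" where
  "pullback_join \<phi> s \<alpha> n =
     (\<lambda>\<tau>. \<Inter>i\<in>{1..n}. \<phi> (s i) -` \<tau> i) ` ({1..n} \<rightarrow>\<^sub>E \<alpha>)"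

definition sequence_entropy ::
    "('g \<Rightarrow> 'x \<Rightarrow> 'x) \<Rightarrow> 'x measure \<Rightarrow> (nat \<Rightarrow> 'g) \<Rightarrow> 'x set set \<Rightarrow> ereal" where
  "sequence_entropy \<phi> \<mu> s \<alpha> =
     limsup (\<lambda>n. ereal (1 / real n * partition_entropy \<mu> (pullback_join \<phi> s \<alpha> n)))"

definition max_sequence_entropy_of ::
    "('g, 'm) monoid_scheme \<Rightarrow> ('g \<Rightarrow> 'x \<Rightarrow> 'x) \<Rightarrow> 'x measure \<Rightarrow> 'x set set \<Rightarrow> ereal" where
  "max_sequence_entropy_of G \<phi> \<mu> \<alpha> =
     (SUP s\<in>{s. range s \<subseteq> carrier G}. sequence_entropy \<phi> \<mu> s \<alpha>)"

definition max_sequence_entropy ::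
    "('g, 'm) monoid_scheme \<Rightarrow> ('g \<Rightarrow> 'x \<Rightarrow> 'x) \<Rightarrow> 'x measure \<Rightarrow> ereal" where
  "max_sequence_entropy G \<phi> \<mu> =
     (SUP \<alpha>\<in>measurable_partitions \<mu>. max_sequence_entropy_of G \<phi> \<mu> \<alpha>)"

definition independence_set ::
    "('g, 'm) monoid_scheme \<Rightarrow> ('g \<Rightarrow> 'x \<Rightarrow> 'x) \<Rightarrow> nat \<Rightarrow> (nat \<Rightarrow> 'x set) \<Rightarrow> 'g set \<Rightarrow> bool" where
  "independence_set G \<phi> K A J \<longleftrightarrow>
     J \<subseteq> carrier G \<and>
     (\<forall>I. I \<subseteq> J \<and> finite I \<and> I \<noteq> {} \<longrightarrow>
        (\<forall>\<sigma>\<in>I \<rightarrow> {1..K}. (\<Inter>g\<in>I. \<phi> g -` A (\<sigma> g)) \<noteq> {}))"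

definition IT_tuple ::
    "('g, 'm) monoid_scheme \<Rightarrow> ('g \<Rightarrow> 'x::topological_space \<Rightarrow> 'x) \<Rightarrow> nat \<Rightarrow> (nat \<Rightarrow> 'x) \<Rightarrow> bool" where
  "IT_tuple G \<phi> K x \<longleftrightarrow>
     (\<forall>U. (\<forall>k\<in>{1..K}. open (U k) \<and> x k \<in> U k) \<longrightarrow>
        (\<exists>J. infinite J \<and> independence_set G \<phi> K U J))"

definition essential_tuple :: "nat \<Rightarrow> (nat \<Rightarrow> 'x) \<Rightarrow> bool" where
  "essential_tuple K x \<longleftrightarrow> (\<forall>i j. 1 \<le> i \<and> i < j \<and> j \<le> K \<longrightarrow> x i \<noteq> x j)"

end

theory Submission
  imports Defs "HOL-Probability.Probability"
begin

text \<open>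
  Let \<open>h n\<close> be the entropy of the join of the first \<open>n\<close> preimages of \<open>\<alpha>\<close> along a sequence \<open>s\<close>. If the
  sequence entropy exceeds \<open>ln (K - 1)\<close>, the increments of \<open>h\<close> exceed some \<open>c > ln (K - 1)\<close>
  infinitely often. By Tychonoff there is a filter \<open>F\<close>, concentrated on those times \<open>i\<close>, along which
  \<open>\<mu> (W \<inter> s\<^sub>i\<^sup>-\<^sup>1 D)\<close> converges to some \<open>\<nu> W D\<close> for all Borel \<open>W\<close> and \<open>D\<close>. As a function of \<open>W\<close>, the
  limit is dominated by \<open>\<mu>\<close>; for \<open>A \<in> \<alpha>\<close> it has a largest zero set, measurable with respect to
  the past, that is, the \<open>\<sigma>\<close>-algebra generated by the \<open>s\<^sub>j\<^sup>-\<^sup>1 \<alpha>\<close>. If almost every point lay outside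
  the zero sets of at most \<open>K - 1\<close> atoms, then the past up to a fixed time would predict the
  \<open>i\<close>-th symbol up to \<open>K - 1\<close> choices with an error tending to 0 along \<open>F\<close>, and the increments of \<open>h\<close>
  would be at most \<open>ln (K - 1) + o(1)\<close>.

  So there are \<open>K\<close> atoms \<open>A\<^sub>k\<close> and a set \<open>B\<close> of positive measure with \<open>\<nu> W A\<^sub>k > 0\<close> for all
  \<open>W \<subseteq> B\<close> of positive measure. Inner regularity and a countable base yield points
  \<open>y\<^sub>k \<in> A\<^sub>k\<close>, distinct since the atoms are disjoint, all of whose neighbourhoods have the same property
  with a smaller \<open>B\<close>. For disjoint sets \<open>D\<^sub>k\<close> with this property an infinite independence set is chosen
  greedily: if every finite pattern has positive measure inside \<open>B\<close>, then the same is true after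
  adding \<open>s\<^sub>i\<close>, for \<open>i\<close> far along \<open>F\<close>.
\<close>

subsection \<open>Preliminaries\<close>

text \<open>By Tychonoff the cube is compact, so the image of \<open>F\<close> under
  \<open>f\<close> has a cluster point; refining \<open>F\<close> by the preimages of its
  neighbourhoods forces convergence in every coordinate. Filters replace subsequences because there
  may be uncountably many coordinates \<open>a\<close>.\<close>

lemma cluster_filter:
  fixes f :: "'i \<Rightarrow> 'a \<Rightarrow> real"
  assumes "F \<noteq> bot" and f: "\<And>i a. f i a \<in> {0..1}"
  obtains F' l where "F' \<noteq> bot" "F' \<le> F" "\<And>a. ((\<lambda>i. f i a) \<longlongrightarrow> l a) F'"
proof -
  have "compactin (product_topology (\<lambda>_::'a. euclidean) UNIV) (PiE UNIV (\<lambda>_. {0..1::real}))"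
    by (simp add: compactin_PiE)
  then have "compact (PiE UNIV (\<lambda>_::'a. {0..1::real}))"
    by (simp add: euclidean_product_topology)
  moreover have "eventually (\<lambda>x. x \<in> PiE UNIV (\<lambda>_. {0..1})) (filtermap f F)"
    using f by (simp add: eventually_filtermap PiE_iff)
  moreover have "filtermap f F \<noteq> bot"
    using assms(1) by (simp add: filtermap_bot_iff)
  ultimately obtain x where x: "inf (nhds x) (filtermap f F) \<noteq> bot"
    unfolding compact_filter by blast
  define F' where "F' = inf F (filtercomap f (nhds x))"
  have "F' \<noteq> bot"
  proof
    assume "F' = bot"
    then have "eventually (\<lambda>_. False) F'" by simp
    then obtain P Q where P: "eventually P F" "eventually Q (filtercomap f (nhds x))"
      "\<And>i. P i \<Longrightarrow> Q i \<Longrightarrow> False"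
      unfolding F'_def eventually_inf by blast
    from P(2) obtain R where R: "eventually R (nhds x)" "\<And>i. R (f i) \<Longrightarrow> Q i"
      unfolding eventually_filtercomap by blast
    have "eventually (\<lambda>y. \<not> R y) (filtermap f F)"
      unfolding eventually_filtermap using P(1) by eventually_elim (use P(3) R(2) in blast)
    then have "eventually (\<lambda>_. False) (inf (nhds x) (filtermap f F))"
      unfolding eventually_inf using R(1) by blast
    then show False using x by simp
  qed
  moreover have "F' \<le> F" by (simp add: F'_def)
  moreover have lim: "filterlim f (nhds x) F'"
    unfolding F'_def by (rule filterlim_mono[OF filterlim_filtercomap order_refl]) simp
  have "((\<lambda>i. f i a) \<longlongrightarrow> x a) F'" for a
  proof -
    have "continuous_on UNIV (\<lambda>g::'a \<Rightarrow> real. g a)"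
      by (rule continuous_on_product_coordinates)
    from continuous_on_tendsto_compose[OF this lim] show ?thesis by simp
  qed
  ultimately show ?thesis using that by blast
qed

text \<open>Exhaustion: zero sets are closed under finite unions, and \<open>Z\<close> is the union
  of an increasing sequence of them whose measures approach the supremum \<open>s\<close>.
  Domination by the measure stands in for countable additivity of \<open>\<nu>\<close>: what
  \<open>Z\<close> adds to \<open>U N\<close> has small measure, hence small
  \<open>\<nu>\<close>.\<close>

lemma (in finite_measure) zero_set_exists:
  fixes \<nu> :: "'a set \<Rightarrow> real"
  assumes nonneg: "\<And>W. W \<in> sets M \<Longrightarrow> 0 \<le> \<nu> W"
    and le: "\<And>W. W \<in> sets M \<Longrightarrow> \<nu> W \<le> measure M W"
    and subadd: "\<And>A B. A \<in> sets M \<Longrightarrow> B \<in> sets M \<Longrightarrow> \<nu> (A \<union> B) \<le> \<nu> A + \<nu> B"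
  obtains Z where "Z \<in> sets M" "\<nu> Z = 0"
    "\<And>W. W \<in> sets M \<Longrightarrow> W \<inter> Z = {} \<Longrightarrow> measure M W > 0 \<Longrightarrow> \<nu> W > 0"
proof -
  define ZZ where "ZZ = {Z \<in> sets M. \<nu> Z = 0}"
  define s where "s = (SUP Z\<in>ZZ. measure M Z)"
  have emp: "{} \<in> ZZ" using nonneg[of "{}"] le[of "{}"] by (simp add: ZZ_def)
  have bdd: "bdd_above (measure M ` ZZ)"
    by (rule bdd_aboveI2[where M="measure M (space M)"]) (simp add: bounded_measure)
  have "\<exists>Z\<in>ZZ. measure M Z > s - 1 / Suc n" for n
  proof (rule ccontr)
    assume "\<not> ?thesis"
    then have "\<And>Z. Z \<in> ZZ \<Longrightarrow> measure M Z \<le> s - 1 / Suc n" by force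
    then have "s \<le> s - 1 / Suc n" unfolding s_def using emp by (intro cSUP_least) auto
    then show False by simp
  qed
  then obtain z where z: "\<And>n. z n \<in> ZZ" "\<And>n. measure M (z n) > s - 1 / Suc n" by metis
  have un: "A \<union> B \<in> ZZ" if "A \<in> ZZ" "B \<in> ZZ" for A B
    using that subadd[of A B] nonneg[of "A \<union> B"] by (auto simp: ZZ_def)
  define U where "U N = (\<Union>n\<le>N. z n)" for N :: nat
  define Z where "Z = (\<Union>N. U N)"
  have U: "U N \<in> ZZ" for N
  proof (induction N)
    case 0 then show ?case using z(1) by (simp add: U_def)
  next
    case (Suc N)
    have "U (Suc N) = z (Suc N) \<union> U N" by (simp add: U_def atMost_Suc)
    then show ?case using un z(1) Suc by metis
  qed
  then have Us: "U N \<in> sets M" for N by (auto simp: ZZ_def)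
  then have Zs: "Z \<in> sets M" by (auto simp: Z_def)
  have "(\<lambda>N. measure M (U N)) \<longlonglongrightarrow> measure M Z"
    unfolding Z_def using Us
    by (intro finite_Lim_measure_incseq) (auto simp: incseq_def U_def intro: order_trans)
  then have lim: "(\<lambda>N. measure M Z - measure M (U N)) \<longlonglongrightarrow> measure M Z - measure M Z"
    by (intro tendsto_intros)
  have "\<nu> Z \<le> measure M Z - measure M (U N)" for N
  proof -
    have sub: "U N \<subseteq> Z" by (auto simp: Z_def)
    have "\<nu> Z = \<nu> (U N \<union> (Z - U N))" using sub by (simp add: Un_absorb1)
    also have "\<dots> \<le> \<nu> (U N) + \<nu> (Z - U N)" using Us Zs by (intro subadd) auto
    also have "\<dots> \<le> measure M (Z - U N)" using U[of N] le[of "Z - U N"] Us Zs by (auto simp: ZZ_def)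
    also have "\<dots> = measure M Z - measure M (U N)" using sub Us Zs by (intro finite_measure_Diff) auto
    finally show ?thesis .
  qed
  then have "\<nu> Z \<le> 0" using LIMSEQ_le_const[OF lim] by simp
  then have nuZ: "\<nu> Z = 0" using nonneg[OF Zs] by simp
  have "s - 1 / Suc n \<le> measure M Z" for n
  proof -
    have "measure M (z n) \<le> measure M Z"
      using Zs by (intro finite_measure_mono) (auto simp: Z_def U_def)
    then show ?thesis using z(2)[of n] by simp
  qed
  moreover have "(\<lambda>n. s - 1 / Suc n) \<longlonglongrightarrow> s - 0"
    by (intro tendsto_intros LIMSEQ_Suc[OF lim_1_over_n])
  ultimately have sZ: "s \<le> measure M Z" by (intro LIMSEQ_le_const2[of _ "s"]) auto
  show ?thesis
  proof (rule that[OF Zs nuZ])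
    fix W assume W: "W \<in> sets M" "W \<inter> Z = {}" "measure M W > 0"
    show "\<nu> W > 0"
    proof (rule ccontr)
      assume "\<not> \<nu> W > 0"
      then have "\<nu> W = 0" using nonneg[OF W(1)] by simp
      \<comment> \<open>A zero set of positive measure disjoint from \<open>Z\<close> could be added
        to \<open>Z\<close>, exceeding the supremum.\<close>
      then have "Z \<union> W \<in> ZZ" using un nuZ Zs W(1) by (simp add: ZZ_def)
      then have "measure M (Z \<union> W) \<le> s" unfolding s_def by (intro cSUP_upper bdd)
      moreover have "measure M (Z \<union> W) = measure M Z + measure M W"
        using Zs W by (intro finite_measure_Union) auto
      ultimately show False using sZ W by simp
    qed
  qed
qed

text \<open>Gibbs' inequality row by row: with \<open>P\<close> the sum of the row \<open>a\<close>,
  \<open>ln t \<le> t - 1\<close> is applied to \<open>t = P * r a b / p a b\<close>. For a joint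
  distribution \<open>p\<close> the first term on the right is a marginal entropy, so the second one
  bounds the conditional entropy.\<close>

lemma entropy_le_cross_entropy:
  fixes p r :: "'a \<Rightarrow> 'b \<Rightarrow> real"
  assumes "finite B"
    and p: "\<And>a b. a \<in> A \<Longrightarrow> b \<in> B \<Longrightarrow> p a b \<ge> 0"
    and r: "\<And>a b. a \<in> A \<Longrightarrow> b \<in> B \<Longrightarrow> r a b > 0"
    and r1: "\<And>a. a \<in> A \<Longrightarrow> (\<Sum>b\<in>B. r a b) \<le> 1"
  shows "- (\<Sum>a\<in>A. \<Sum>b\<in>B. p a b * ln (p a b))
    \<le> - (\<Sum>a\<in>A. (\<Sum>b\<in>B. p a b) * ln (\<Sum>b\<in>B. p a b)) + (\<Sum>a\<in>A. \<Sum>b\<in>B. p a b * - ln (r a b))"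
proof -
  have "- (\<Sum>b\<in>B. p a b * ln (p a b))
    \<le> - ((\<Sum>b\<in>B. p a b) * ln (\<Sum>b\<in>B. p a b)) + (\<Sum>b\<in>B. p a b * - ln (r a b))" if a: "a \<in> A" for a
  proof -
    define P where "P = (\<Sum>b\<in>B. p a b)"
    have "p a b * (ln P + ln (r a b) - ln (p a b)) \<le> P * r a b - p a b" if b: "b \<in> B" for b
    proof (cases "p a b = 0")
      case True
      have "P \<ge> 0" unfolding P_def using p a by (intro sum_nonneg) auto
      then show ?thesis using True r[OF a b] by simp
    next
      case False
      then have pp: "p a b > 0" using p[OF a b] by simp
      have "p a b \<le> P" unfolding P_def using p a b assms(1) by (intro member_le_sum) auto
      then have P: "P > 0" using pp by simp
      have "ln P + ln (r a b) - ln (p a b) = ln (P * r a b / p a b)"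
        using P pp r[OF a b] by (simp add: ln_div ln_mult)
      also have "\<dots> \<le> P * r a b / p a b - 1"
        using P pp r[OF a b] by (intro ln_le_minus_one) auto
      finally have "p a b * (ln P + ln (r a b) - ln (p a b)) \<le> p a b * (P * r a b / p a b - 1)"
        using pp by (intro mult_left_mono) auto
      also have "\<dots> = P * r a b - p a b" using pp by (simp add: field_simps)
      finally show ?thesis .
    qed
    then have "(\<Sum>b\<in>B. p a b * (ln P + ln (r a b) - ln (p a b))) \<le> (\<Sum>b\<in>B. P * r a b - p a b)"
      by (rule sum_mono)
    also have "\<dots> = P * (\<Sum>b\<in>B. r a b) - P"
      by (simp add: sum_subtractf sum_distrib_left P_def)
    also have "\<dots> \<le> 0"
    proof -
      have "P \<ge> 0" unfolding P_def using p a by (intro sum_nonneg) auto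
      then show ?thesis using r1[OF a] by (simp add: mult_left_le)
    qed
    also have "(\<Sum>b\<in>B. p a b * (ln P + ln (r a b) - ln (p a b)))
      = P * ln P + (\<Sum>b\<in>B. p a b * ln (r a b)) - (\<Sum>b\<in>B. p a b * ln (p a b))"
      by (simp add: right_diff_distrib distrib_left sum.distrib sum_subtractf P_def sum_distrib_right)
    finally show ?thesis by (simp add: P_def sum_negf)
  qed
  then have "(\<Sum>a\<in>A. - (\<Sum>b\<in>B. p a b * ln (p a b)))
    \<le> (\<Sum>a\<in>A. - ((\<Sum>b\<in>B. p a b) * ln (\<Sum>b\<in>B. p a b)) + (\<Sum>b\<in>B. p a b * - ln (r a b)))"
    by (rule sum_mono)
  then show ?thesis by (simp add: sum.distrib sum_negf sum_subtractf)
qed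

text \<open>Summing increments bounds \<open>h n\<close> by a constant plus \<open>n * c\<close>,
  and division by \<open>n\<close> removes the constant in the limit.\<close>

lemma limsup_le_of_increments:
  fixes h :: "nat \<Rightarrow> real"
  assumes "eventually (\<lambda>n. h (Suc n) \<le> h n + c) sequentially"
  shows "limsup (\<lambda>n. ereal (1 / real n * h n)) \<le> ereal c"
proof -
  obtain N where N: "\<And>n. n \<ge> N \<Longrightarrow> h (Suc n) \<le> h n + c"
    using assms unfolding eventually_sequentially by blast
  have le: "h n \<le> (h N - real N * c) + real n * c" if "n \<ge> N" for n
    using that
  proof (induction rule: dec_induct)
    case base then show ?case by simp
  next
    case (step n) then show ?case using N[of n] by (simp add: algebra_simps)
  qed
  have "eventually (\<lambda>n. ereal (1 / real n * h n) \<le> ereal ((h N - real N * c) * (1 / real n) + c)) sequentially"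
    using eventually_ge_at_top[of "max 1 N"]
  proof eventually_elim
    case (elim n)
    then have "1 / real n * h n \<le> 1 / real n * ((h N - real N * c) + real n * c)"
      using le by (intro mult_left_mono) auto
    also have "\<dots> = (h N - real N * c) * (1 / real n) + c" using elim by (simp add: field_simps)
    finally show ?case by simp
  qed
  then have "limsup (\<lambda>n. ereal (1 / real n * h n)) \<le> limsup (\<lambda>n. ereal ((h N - real N * c) * (1 / real n) + c))"
    by (rule Limsup_mono)
  also have "(\<lambda>n. (h N - real N * c) * (1 / real n) + c) \<longlonglongrightarrow> (h N - real N * c) * 0 + c"
    by (intro tendsto_intros lim_1_over_n)
  then have "(\<lambda>n. ereal ((h N - real N * c) * (1 / real n) + c)) \<longlonglongrightarrow> ereal c" by simp
  then have "limsup (\<lambda>n. ereal ((h N - real N * c) * (1 / real n) + c)) = ereal c"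
    by (intro lim_imp_Limsup) auto
  finally show ?thesis .
qed

subsection \<open>Block entropy of finite-valued processes\<close>

text \<open>Measurability is stated through fibres, so that the value type carries no
  \<sigma>-algebra; in the application the values are the members of a partition.\<close>

locale finite_process = prob_space M for M :: "'a measure" +
  fixes \<xi> :: "nat \<Rightarrow> 'a \<Rightarrow> 'b" and Y :: "'b set"
  assumes finite_Y: "finite Y"
    and fiber_sets: "\<And>i y. y \<in> Y \<Longrightarrow> {x \<in> space M. \<xi> i x = y} \<in> sets M"
    and in_Y: "\<And>i x. x \<in> space M \<Longrightarrow> \<xi> i x \<in> Y"
begin

definition cyl :: "nat \<Rightarrow> (nat \<Rightarrow> 'b) \<Rightarrow> 'a set" where
  "cyl n \<tau> = {x \<in> space M. \<forall>i\<in>{1..n}. \<xi> i x = \<tau> i}"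

definition block_entropy :: "nat \<Rightarrow> real" where
  "block_entropy n = - (\<Sum>\<tau>\<in>{1..n} \<rightarrow>\<^sub>E Y. prob (cyl n \<tau>) * ln (prob (cyl n \<tau>)))"

text \<open>These are the unions of cylinders of length \<open>n\<close>, described pointwise so
  that complements and unions need no bookkeeping of words.\<close>

definition determined :: "nat \<Rightarrow> 'a set \<Rightarrow> bool" where
  "determined n E \<longleftrightarrow> E \<subseteq> space M \<and>
     (\<forall>x\<in>E. \<forall>x'\<in>space M. (\<forall>i\<in>{1..n}. \<xi> i x' = \<xi> i x) \<longrightarrow> x' \<in> E)"

lemma Y_nonempty: "Y \<noteq> {}"
  using not_empty in_Y by blast

lemma cyl_sets [measurable]: "\<tau> \<in> {1..n} \<rightarrow>\<^sub>E Y \<Longrightarrow> cyl n \<tau> \<in> sets M"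
proof -
  assume \<tau>: "\<tau> \<in> {1..n} \<rightarrow>\<^sub>E Y"
  have "cyl n \<tau> = space M \<inter> (\<Inter>i\<in>{1..n}. {x \<in> space M. \<xi> i x = \<tau> i})" if "n \<ge> 1"
    using that by (auto simp: cyl_def)
  moreover have "(\<Inter>i\<in>{1..n}. {x \<in> space M. \<xi> i x = \<tau> i}) \<in> sets M" if "n \<ge> 1"
    using that \<tau> by (intro sets.finite_INT fiber_sets) auto
  moreover have "cyl n \<tau> = space M" if "n = 0" using that by (simp add: cyl_def)
  ultimately show ?thesis by (cases "n = 0") auto
qed

text \<open>Presents cylinders as fibres of the map from points to words, so that summation over
  fibres also applies to words.\<close>

lemma cyl_eq:
  "\<tau> \<in> {1..n} \<rightarrow>\<^sub>E Y \<Longrightarrow> cyl n \<tau> = {x \<in> space M. restrict (\<lambda>i. \<xi> i x) {1..n} = \<tau>}"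
  by (auto simp: cyl_def fun_eq_iff PiE_iff extensional_def restrict_def)

lemma sum_prob_fibers:
  assumes "finite T" "E \<in> sets M" "\<And>t. t \<in> T \<Longrightarrow> {x \<in> space M. f x = t} \<in> sets M"
    "\<And>x. x \<in> space M \<Longrightarrow> f x \<in> T"
  shows "(\<Sum>t\<in>T. prob (E \<inter> {x \<in> space M. f x = t})) = prob E"
proof -
  have "prob (\<Union>t\<in>T. E \<inter> {x \<in> space M. f x = t}) = (\<Sum>t\<in>T. prob (E \<inter> {x \<in> space M. f x = t}))"
    using assms by (intro finite_measure_finite_Union) (auto simp: disjoint_family_on_def)
  moreover have "(\<Union>t\<in>T. E \<inter> {x \<in> space M. f x = t}) = E"
    using assms(4) sets.sets_into_space[OF assms(2)] by auto
  ultimately show ?thesis by simp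
qed

lemma sum_prob_fiber:
  "E \<in> sets M \<Longrightarrow> (\<Sum>y\<in>Y. prob (E \<inter> {x \<in> space M. \<xi> i x = y})) = prob E"
  using finite_Y fiber_sets in_Y by (intro sum_prob_fibers)

lemma finite_words: "finite ({1..n::nat} \<rightarrow>\<^sub>E Y)"
  by (intro finite_PiE) (auto simp: finite_Y)

lemma sum_prob_cyl:
  assumes "E \<in> sets M"
  shows "(\<Sum>\<tau>\<in>{1..n} \<rightarrow>\<^sub>E Y. prob (E \<inter> cyl n \<tau>)) = prob E"
proof -
  have "(\<Sum>\<tau>\<in>{1..n} \<rightarrow>\<^sub>E Y. prob (E \<inter> {x \<in> space M. restrict (\<lambda>i. \<xi> i x) {1..n} = \<tau>})) = prob E"
    using finite_words assms
  proof (rule sum_prob_fibers)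
    show "{x \<in> space M. restrict (\<lambda>i. \<xi> i x) {1..n} = \<tau>} \<in> sets M" if "\<tau> \<in> {1..n} \<rightarrow>\<^sub>E Y" for \<tau>
      using cyl_sets[OF that] cyl_eq[OF that] by simp
  qed (use in_Y in auto)
  moreover have "prob (E \<inter> {x \<in> space M. restrict (\<lambda>i. \<xi> i x) {1..n} = \<tau>}) = prob (E \<inter> cyl n \<tau>)"
    if "\<tau> \<in> {1..n} \<rightarrow>\<^sub>E Y" for \<tau>
    using cyl_eq[OF that] by simp
  ultimately show ?thesis by simp
qed

lemma determined_sets:
  assumes "determined n E" shows "E \<in> sets M"
proof -
  have "E = (\<Union>\<tau>\<in>{\<tau> \<in> {1..n} \<rightarrow>\<^sub>E Y. cyl n \<tau> \<inter> E \<noteq> {}}. cyl n \<tau>)"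
  proof (intro equalityI subsetI)
    fix x assume x: "x \<in> E"
    then have xs: "x \<in> space M" using assms by (auto simp: determined_def)
    have "x \<in> cyl n (restrict (\<lambda>i. \<xi> i x) {1..n})" using xs by (simp add: cyl_def)
    moreover have "restrict (\<lambda>i. \<xi> i x) {1..n} \<in> {1..n} \<rightarrow>\<^sub>E Y" using in_Y xs by auto
    ultimately show "x \<in> (\<Union>\<tau>\<in>{\<tau> \<in> {1..n} \<rightarrow>\<^sub>E Y. cyl n \<tau> \<inter> E \<noteq> {}}. cyl n \<tau>)" using x by blast
  next
    fix x assume "x \<in> (\<Union>\<tau>\<in>{\<tau> \<in> {1..n} \<rightarrow>\<^sub>E Y. cyl n \<tau> \<inter> E \<noteq> {}}. cyl n \<tau>)"
    then obtain \<tau> x' where "x \<in> cyl n \<tau>" "x' \<in> cyl n \<tau>" "x' \<in> E" by blast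
    then show "x \<in> E" using assms by (auto simp: determined_def cyl_def)
  qed
  moreover have "(\<Union>\<tau>\<in>{\<tau> \<in> {1..n} \<rightarrow>\<^sub>E Y. cyl n \<tau> \<inter> E \<noteq> {}}. cyl n \<tau>) \<in> sets M"
    using finite_words by (intro sets.finite_UN) auto
  ultimately show ?thesis by simp
qed

lemma determined_mono: "determined m E \<Longrightarrow> m \<le> n \<Longrightarrow> determined n E"
  unfolding determined_def
  by (meson atLeastAtMost_iff order_trans)

text \<open>Splitting off the last symbol of a word brings the entropy into the row form of
  \<open>entropy_le_cross_entropy\<close>.\<close>

lemma block_entropy_Suc:
  "block_entropy (Suc n) = - (\<Sum>\<tau>\<in>{1..n} \<rightarrow>\<^sub>E Y. \<Sum>y\<in>Y.
     prob (cyl n \<tau> \<inter> {x \<in> space M. \<xi> (Suc n) x = y}) * ln (prob (cyl n \<tau> \<inter> {x \<in> space M. \<xi> (Suc n) x = y})))"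
proof -
  define q where "q \<tau> = prob (cyl (Suc n) \<tau>) * ln (prob (cyl (Suc n) \<tau>))" for \<tau>
  have ins: "{1..Suc n} = insert (Suc n) {1..n}" by auto
  have cylS: "cyl (Suc n) (\<tau>(Suc n := y)) = cyl n \<tau> \<inter> {x \<in> space M. \<xi> (Suc n) x = y}" for \<tau> y
    by (auto simp: cyl_def ins)
  have "(\<Sum>\<tau>\<in>{1..Suc n} \<rightarrow>\<^sub>E Y. q \<tau>) = (\<Sum>(y, \<tau>)\<in>Y \<times> ({1..n} \<rightarrow>\<^sub>E Y). q (\<tau>(Suc n := y)))"
    unfolding ins PiE_insert_eq
    by (subst sum.reindex[OF inj_combinator]) (auto simp: case_prod_unfold)
  also have "\<dots> = (\<Sum>y\<in>Y. \<Sum>\<tau>\<in>{1..n} \<rightarrow>\<^sub>E Y. q (\<tau>(Suc n := y)))"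
    by (rule sum.cartesian_product[symmetric])
  also have "\<dots> = (\<Sum>\<tau>\<in>{1..n} \<rightarrow>\<^sub>E Y. \<Sum>y\<in>Y. q (\<tau>(Suc n := y)))" by (rule sum.swap)
  finally show ?thesis unfolding block_entropy_def q_def cylS by simp
qed

text \<open>
  Here \<open>S\<close> predicts the next symbol from the past; the bound is Gibbs' inequality against the conditional
  law that mixes the uniform distribution on \<open>S\<close> with a small multiple of the uniform one on \<open>Y\<close>.
\<close>

lemma block_entropy_increment:
  fixes S :: "'a \<Rightarrow> 'b set" and k :: nat and e :: real
  assumes k: "k \<ge> 1" and e: "0 < e" "e < 1"
    and S: "\<And>x. x \<in> space M \<Longrightarrow> S x \<subseteq> Y" "\<And>x. x \<in> space M \<Longrightarrow> card (S x) \<le> k"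
    and det: "\<And>x x'. x \<in> space M \<Longrightarrow> x' \<in> space M \<Longrightarrow> (\<And>i. i \<in> {1..n} \<Longrightarrow> \<xi> i x = \<xi> i x') \<Longrightarrow> S x = S x'"
  shows "block_entropy (Suc n) \<le> block_entropy n - ln ((1 - e) / k)
    + ln (card Y / e) * prob {x \<in> space M. \<xi> (Suc n) x \<notin> S x}"
proof -
  define fib where "fib y = {x \<in> space M. \<xi> (Suc n) x = y}" for y
  have fib: "fib y \<in> sets M" if "y \<in> Y" for y using fiber_sets that by (simp add: fib_def)
  define bad where "bad = {x \<in> space M. \<xi> (Suc n) x \<notin> S x}"
  define W where "W = {1..n} \<rightarrow>\<^sub>E Y"
  \<comment> \<open>The prediction as a function of the word: by \<open>det\<close> it equals
    \<open>S x\<close> for every \<open>x\<close> in the cylinder, and it is empty for an empty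
    cylinder.\<close>
  define SS where "SS \<tau> = {y. \<exists>x\<in>cyl n \<tau>. y \<in> S x}" for \<tau>
  define p where "p \<tau> y = prob (cyl n \<tau> \<inter> fib y)" for \<tau> y
  define r where "r \<tau> y = (if y \<in> SS \<tau> then (1 - e) / k else 0) + e / card Y" for \<tau> y
  have cY: "card Y > 0" using finite_Y Y_nonempty by (simp add: card_gt_0_iff)
  have SS: "SS \<tau> = S x" if "x \<in> cyl n \<tau>" for x \<tau>
  proof -
    have "S x' = S x" if "x' \<in> cyl n \<tau>" for x'
      using that \<open>x \<in> cyl n \<tau>\<close> by (intro det) (auto simp: cyl_def)
    then show ?thesis using that unfolding SS_def by blast
  qed
  have SSc: "SS \<tau> \<subseteq> Y \<and> card (SS \<tau>) \<le> k" for \<tau>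
  proof (cases "cyl n \<tau> = {}")
    case True then show ?thesis by (simp add: SS_def)
  next
    case False
    then obtain x where "x \<in> cyl n \<tau>" by blast
    then show ?thesis using SS[of x \<tau>] S[of x] by (auto simp: cyl_def)
  qed
  \<comment> \<open>Measurability rests on \<open>det\<close>: whether \<open>y\<close> is predicted
    depends only on the first \<open>n\<close> symbols.\<close>
  have bad: "bad \<in> sets M"
  proof -
    have "determined n {x \<in> space M. y \<notin> S x}" for y
      unfolding determined_def using det by blast
    then have "{x \<in> space M. y \<notin> S x} \<in> sets M" for y by (rule determined_sets)
    then have "(\<Union>y\<in>Y. fib y \<inter> {x \<in> space M. y \<notin> S x}) \<in> sets M"
      using finite_Y fib by (intro sets.finite_UN) auto
    also have "(\<Union>y\<in>Y. fib y \<inter> {x \<in> space M. y \<notin> S x}) = bad"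
      using in_Y by (auto simp: bad_def fib_def)
    finally show ?thesis .
  qed
  have r_pos: "r \<tau> y > 0" for \<tau> y using e cY by (auto simp: r_def add_nonneg_pos)
  have r_sum: "(\<Sum>y\<in>Y. r \<tau> y) \<le> 1" for \<tau>
  proof -
    have "(\<Sum>y\<in>Y. r \<tau> y) = card (SS \<tau>) * ((1 - e) / k) + e"
      using SSc[of \<tau>] cY finite_Y Y_nonempty by (simp add: r_def sum.distrib sum.If_cases Int_absorb1)
    also have "\<dots> \<le> k * ((1 - e) / k) + e"
      using SSc e by (intro add_right_mono mult_right_mono) auto
    also have "\<dots> = 1" using k by simp
    finally show ?thesis .
  qed
  define b where "b = ln (card Y / e)"
  define a where "a = - ln ((1 - e) / k)"
  have b: "b \<ge> 0" using e cY by (simp add: b_def)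
  have a: "a \<ge> 0" using e k by (simp add: a_def)
  \<comment> \<open>A predicted symbol costs at most \<open>a\<close>, any other at most
    \<open>a + b\<close>. Summed against \<open>p\<close>, the cost \<open>a\<close> is paid with
    total mass 1 and the extra \<open>b\<close> only on \<open>bad\<close>.\<close>
  have r_ln: "- ln (r \<tau> y) \<le> a + (if y \<in> SS \<tau> then 0 else b)" for \<tau> y
  proof (cases "y \<in> SS \<tau>")
    case True
    have "(1 - e) / k \<le> r \<tau> y" using True e by (simp add: r_def)
    then have "ln ((1 - e) / k) \<le> ln (r \<tau> y)" using e k r_pos by (subst ln_le_cancel_iff) auto
    then show ?thesis using True by (simp add: a_def)
  next
    case False
    have "- ln (r \<tau> y) = b" using False e cY by (simp add: r_def b_def ln_div)
    then show ?thesis using False a by simp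
  qed
  have psum: "(\<Sum>y\<in>Y. p \<tau> y) = prob (cyl n \<tau>)" if "\<tau> \<in> W" for \<tau>
    unfolding p_def fib_def using that by (intro sum_prob_fiber) (auto simp: W_def)
  have "block_entropy (Suc n) = - (\<Sum>\<tau>\<in>W. \<Sum>y\<in>Y. p \<tau> y * ln (p \<tau> y))"
    unfolding block_entropy_Suc p_def fib_def W_def ..
  also have "\<dots> \<le> - (\<Sum>\<tau>\<in>W. (\<Sum>y\<in>Y. p \<tau> y) * ln (\<Sum>y\<in>Y. p \<tau> y)) + (\<Sum>\<tau>\<in>W. \<Sum>y\<in>Y. p \<tau> y * - ln (r \<tau> y))"
    using finite_Y r_pos r_sum by (intro entropy_le_cross_entropy) (auto simp: p_def)
  also have "- (\<Sum>\<tau>\<in>W. (\<Sum>y\<in>Y. p \<tau> y) * ln (\<Sum>y\<in>Y. p \<tau> y)) = block_entropy n"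
    using psum by (simp add: block_entropy_def W_def)
  also have "(\<Sum>\<tau>\<in>W. \<Sum>y\<in>Y. p \<tau> y * - ln (r \<tau> y)) \<le>
     (\<Sum>\<tau>\<in>W. \<Sum>y\<in>Y. a * p \<tau> y + b * prob (bad \<inter> cyl n \<tau> \<inter> fib y))"
  proof (intro sum_mono)
    fix \<tau> y assume "\<tau> \<in> W" "y \<in> Y"
    have "p \<tau> y * - ln (r \<tau> y) \<le> p \<tau> y * (a + (if y \<in> SS \<tau> then 0 else b))"
      using r_ln by (intro mult_left_mono) (auto simp: p_def)
    also have "\<dots> \<le> a * p \<tau> y + b * prob (bad \<inter> cyl n \<tau> \<inter> fib y)"
    proof (cases "y \<in> SS \<tau>")
      case True then show ?thesis using b by simp
    next
      case False
      \<comment> \<open>A symbol outside \<open>SS \<tau>\<close> is mispredicted on the whole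
        cylinder.\<close>
      have "bad \<inter> cyl n \<tau> \<inter> fib y = cyl n \<tau> \<inter> fib y"
        using False SS by (auto simp: bad_def fib_def)
      then show ?thesis using False by (simp add: p_def algebra_simps)
    qed
    finally show "p \<tau> y * - ln (r \<tau> y) \<le> a * p \<tau> y + b * prob (bad \<inter> cyl n \<tau> \<inter> fib y)" .
  qed
  also have "\<dots> = a * (\<Sum>\<tau>\<in>W. \<Sum>y\<in>Y. p \<tau> y) + b * (\<Sum>\<tau>\<in>W. \<Sum>y\<in>Y. prob (bad \<inter> cyl n \<tau> \<inter> fib y))"
    by (simp add: sum.distrib sum_distrib_left)
  also have "(\<Sum>\<tau>\<in>W. \<Sum>y\<in>Y. p \<tau> y) = 1"
  proof -
    have "(\<Sum>\<tau>\<in>W. \<Sum>y\<in>Y. p \<tau> y) = (\<Sum>\<tau>\<in>W. prob (space M \<inter> cyl n \<tau>))"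
      using psum by (intro sum.cong) (auto simp: cyl_def Int_absorb1)
    then show ?thesis using sum_prob_cyl[of "space M" n] prob_space by (simp add: W_def)
  qed
  also have "(\<Sum>\<tau>\<in>W. \<Sum>y\<in>Y. prob (bad \<inter> cyl n \<tau> \<inter> fib y)) = prob bad"
  proof -
    have "(\<Sum>\<tau>\<in>W. \<Sum>y\<in>Y. prob (bad \<inter> cyl n \<tau> \<inter> fib y)) = (\<Sum>\<tau>\<in>W. prob (bad \<inter> cyl n \<tau>))"
      unfolding fib_def using bad by (intro sum.cong sum_prob_fiber) (auto simp: W_def)
    then show ?thesis using sum_prob_cyl[OF bad] by (simp add: W_def)
  qed
  finally show ?thesis by (simp add: a_def b_def bad_def)
qed

section \<open>The \<sigma>-algebra of the past and its approximation by finite words\<close>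

text \<open>Indices start at 1 because \<open>cyl\<close> and \<open>determined\<close> read only
  the symbols numbered from 1 to \<open>n\<close>.\<close>

definition generated :: "'a measure" where
  "generated = sigma (space M) {{x \<in> space M. \<xi> j x = y} | j y. j \<ge> 1 \<and> y \<in> Y}"

lemma space_generated [simp]: "space generated = space M"
  unfolding generated_def by (rule space_measure_of) auto

lemma sets_generated:
  "sets generated = sigma_sets (space M) {{x \<in> space M. \<xi> j x = y} | j y. j \<ge> 1 \<and> y \<in> Y}"
  unfolding generated_def by (rule sets_measure_of) auto

lemma subalgebra_generated: "subalgebra M generated"
proof -
  have "sets generated \<subseteq> sets M"
    unfolding sets_generated using fiber_sets by (intro sets.sigma_sets_subset) auto
  then show ?thesis by (simp add: subalgebra_def)
qed

text \<open>The sets that can be approximated in this way form a \<sigma>-algebra containing the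
  generators: complements keep the symmetric difference, and a countable union is first truncated to
  finitely many sets, each of which is then approximated.\<close>

lemma generated_approx:
  assumes "Z \<in> sets generated" "\<delta> > 0"
  shows "\<exists>m E. determined m E \<and> prob ((Z - E) \<union> (E - Z)) < \<delta>"
  using assms(1)[unfolded sets_generated] assms(2)
proof (induction arbitrary: \<delta>)
  case (Basic a)
  then obtain j y where jy: "j \<ge> 1" "y \<in> Y" "a = {x \<in> space M. \<xi> j x = y}" by blast
  then have "determined j a" by (auto simp: determined_def)
  then show ?case using Basic by (intro exI[of _ j] exI[of _ a]) simp
next
  case Empty
  have "determined 0 {}" by (simp add: determined_def)
  then show ?case using Empty by (intro exI[of _ 0] exI[of _ "{}"]) simp
next
  case (Compl a)
  then obtain m E where E: "determined m E" "prob ((a - E) \<union> (E - a)) < \<delta>" by metis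
  have "determined m (space M - E)" using E(1) unfolding determined_def by (metis Diff_iff Diff_subset)
  moreover have "a \<subseteq> space M"
    using Compl.hyps sigma_sets_into_sp[of "{{x \<in> space M. \<xi> j x = y} | j y. j \<ge> 1 \<and> y \<in> Y}" "space M" a] by auto
  then have "(space M - a - (space M - E)) \<union> (space M - E - (space M - a)) = (a - E) \<union> (E - a)"
    using E(1) by (auto simp: determined_def)
  ultimately show ?case using E(2) by metis
next
  case (Union a)
  have as: "a i \<in> sets M" for i
    using Union.hyps[of i] subalgebra_generated by (auto simp: subalgebra_def sets_generated)
  define U where "U N = (\<Union>i<N. a i)" for N :: nat
  have Us: "U N \<in> sets M" for N using as by (auto simp: U_def)
  have UU: "(\<Union>N. U N) = (\<Union>i. a i)" by (auto simp: U_def)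
  have "(\<lambda>N. prob (U N)) \<longlonglongrightarrow> prob (\<Union>N. U N)"
    using Us by (intro finite_Lim_measure_incseq) (auto simp: incseq_def U_def intro: less_le_trans)
  then have "(\<lambda>N. prob (\<Union>i. a i) - prob (U N)) \<longlonglongrightarrow> prob (\<Union>i. a i) - prob (\<Union>i. a i)"
    unfolding UU by (intro tendsto_intros)
  then have "eventually (\<lambda>N. prob (\<Union>i. a i) - prob (U N) < \<delta> / 2) sequentially"
    using Union.prems by (intro order_tendstoD(2)) auto
  then obtain N where N: "prob (\<Union>i. a i) - prob (U N) < \<delta> / 2"
    using eventually_happens'[OF sequentially_bot] by blast
  \<comment> \<open>One half of \<open>\<delta>\<close> pays for the truncation, the other half is
    shared by the \<open>N\<close> approximations; \<open>N + 1\<close> keeps the share positive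
    when \<open>N = 0\<close>.\<close>
  have d: "\<delta> / 2 / (N + 1) > 0" using Union.prems by simp
  have "\<forall>i. \<exists>m E. determined m E \<and> prob ((a i - E) \<union> (E - a i)) < \<delta> / 2 / (N + 1)"
    using Union.IH[OF d] by (rule allI)
  from choice[OF this] obtain m where
    "\<forall>i. \<exists>E. determined (m i) E \<and> prob ((a i - E) \<union> (E - a i)) < \<delta> / 2 / (N + 1)" by blast
  from choice[OF this] obtain E where E: "\<And>i. determined (m i) (E i)"
    "\<And>i. prob ((a i - E i) \<union> (E i - a i)) < \<delta> / 2 / (N + 1)" by blast
  \<comment> \<open>The sum serves as a common upper bound for the word lengths.\<close>
  define m' where "m' = (\<Sum>i<N. m i)"
  define E' where "E' = (\<Union>i<N. E i)"
  have Es: "E i \<in> sets M" for i using E(1) determined_sets by blast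
  have "determined m' (E i)" if "i < N" for i
  proof (rule determined_mono[OF E(1)])
    show "m i \<le> m'" unfolding m'_def using that by (intro member_le_sum) auto
  qed
  then have "determined m' E'" unfolding determined_def E'_def by (simp add: UN_subset_iff) blast
  moreover have "prob (((\<Union>i. a i) - E') \<union> (E' - (\<Union>i. a i))) < \<delta>"
  proof -
    have "prob (((\<Union>i. a i) - E') \<union> (E' - (\<Union>i. a i)))
      \<le> prob (((\<Union>i. a i) - U N) \<union> (\<Union>i<N. (a i - E i) \<union> (E i - a i)))"
      using as Us Es by (intro finite_measure_mono) (auto simp: U_def E'_def)
    also have "\<dots> \<le> prob ((\<Union>i. a i) - U N) + prob (\<Union>i<N. (a i - E i) \<union> (E i - a i))"
      using as Us Es by (intro measure_Un_le) auto
    also have "prob ((\<Union>i. a i) - U N) = prob (\<Union>i. a i) - prob (U N)"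
      using as Us by (intro finite_measure_Diff) (auto simp: U_def)
    also have "prob (\<Union>i<N. (a i - E i) \<union> (E i - a i)) \<le> (\<Sum>i<N. prob ((a i - E i) \<union> (E i - a i)))"
      using as Es by (intro finite_measure_subadditive_finite) auto
    also have "\<dots> \<le> (\<Sum>i<N. \<delta> / 2 / (N + 1))"
      using E(2) by (intro sum_mono) (auto intro: less_imp_le)
    also have "\<dots> \<le> \<delta> / 2" using Union.prems by (simp add: field_simps)
    finally show ?thesis using N by simp
  qed
  ultimately show ?case by blast
qed

text \<open>By \<open>few\<close>, almost every point lies outside at most \<open>k\<close> of the
  zero sets \<open>Z y\<close>. Predicting the \<open>y\<close> with \<open>x \<notin> Z y\<close>
  fails only if the next symbol is some \<open>y\<close> with \<open>x \<in> Z y\<close>, and the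
  probability of this tends to \<open>\<nu> (Z y) y = 0\<close> along \<open>F\<close>. Replacing
  each \<open>Z y\<close> by a nearby determined set makes the prediction depend on finitely many
  past symbols, as \<open>block_entropy_increment\<close> requires.\<close>

lemma eventually_increment_le:
  fixes \<nu> :: "'a set \<Rightarrow> 'b \<Rightarrow> real" and k :: nat and e :: real
  assumes F: "F \<noteq> bot" "F \<le> sequentially"
    and \<nu>: "\<And>W y. W \<in> sets M \<Longrightarrow> y \<in> Y \<Longrightarrow>
      ((\<lambda>i. prob (W \<inter> {x \<in> space M. \<xi> (Suc i) x = y})) \<longlongrightarrow> \<nu> W y) F"
    and k: "k \<ge> 1" and e: "e > 0"
    and few: "\<And>S B. S \<subseteq> Y \<Longrightarrow> card S > k \<Longrightarrow> B \<in> sets M \<Longrightarrow> prob B > 0 \<Longrightarrow>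
      \<exists>W y. W \<in> sets M \<and> W \<subseteq> B \<and> prob W > 0 \<and> y \<in> S \<and> \<nu> W y \<le> 0"
  shows "eventually (\<lambda>i. block_entropy (Suc i) \<le> block_entropy i + (ln k + e)) F"
proof -
  \<comment> \<open>The zero sets are sought among past events, so that they can be read off
    approximately from finitely many symbols; hence the restricted measure.\<close>
  define N where "N = restr_to_subalg M generated"
  have sub: "subalgebra M generated" by (rule subalgebra_generated)
  have setsN: "sets N = sets generated" unfolding N_def by (rule sets_restr_to_subalg[OF sub])
  have NM: "A \<in> sets M" if "A \<in> sets N" for A using that sub by (auto simp: setsN subalgebra_def)
  have measN: "measure N A = prob A" if "A \<in> sets N" for A
    using emeasure_restr_to_subalg[OF sub, of A] that by (simp add: measure_def N_def setsN[unfolded N_def])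
  interpret N: finite_measure N
    unfolding N_def by (rule finite_measure_restr_to_subalg[OF sub]) (rule finite_measure_axioms)
  interpret C: finite_measure_subalgebra M generated
    by unfold_locales (rule sub)
  define fib where "fib i y = {x \<in> space M. \<xi> (Suc i) x = y}" for i y
  have fib: "fib i y \<in> sets M" if "y \<in> Y" for i y using fiber_sets that by (simp add: fib_def)
  have fibN: "fib i y \<in> sets N" if "y \<in> Y" for i y
    unfolding setsN sets_generated fib_def using that by (intro sigma_sets.Basic) auto
  note \<nu>' = \<nu>[folded fib_def]
  have nn: "0 \<le> \<nu> W y" if "W \<in> sets M" "y \<in> Y" for W y
    using that F by (intro tendsto_lowerbound[OF \<nu>']) auto
  have le: "\<nu> W y \<le> prob W" if "W \<in> sets M" "y \<in> Y" for W y
    using that F fib by (intro tendsto_upperbound[OF \<nu>']) (auto intro!: always_eventually finite_measure_mono)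
  have subadd: "\<nu> (A \<union> B) y \<le> \<nu> A y + \<nu> B y" if "A \<in> sets M" "B \<in> sets M" "y \<in> Y" for A B y
  proof (rule tendsto_le[OF F(1)])
    show "((\<lambda>i. prob ((A \<union> B) \<inter> fib i y)) \<longlongrightarrow> \<nu> (A \<union> B) y) F" using that by (intro \<nu>') auto
    show "((\<lambda>i. prob (A \<inter> fib i y) + prob (B \<inter> fib i y)) \<longlongrightarrow> \<nu> A y + \<nu> B y) F"
      using that by (intro tendsto_intros \<nu>')
    show "eventually (\<lambda>i. prob ((A \<union> B) \<inter> fib i y) \<le> prob (A \<inter> fib i y) + prob (B \<inter> fib i y)) F"
      using that fib by (auto simp: Int_Un_distrib2 intro!: always_eventually measure_Un_le)
  qed
  have "\<exists>Z. Z \<in> sets N \<and> \<nu> Z y = 0 \<and> (\<forall>W\<in>sets N. W \<inter> Z = {} \<longrightarrow> prob W > 0 \<longrightarrow> \<nu> W y > 0)"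
    if y: "y \<in> Y" for y
    by (rule N.zero_set_exists[of "\<lambda>W. \<nu> W y"]) (use y nn le subadd NM measN in auto)
  then obtain Z where ZN: "\<And>y. y \<in> Y \<Longrightarrow> Z y \<in> sets N" and Z0: "\<And>y. y \<in> Y \<Longrightarrow> \<nu> (Z y) y = 0"
    and Zpos: "\<And>y W. y \<in> Y \<Longrightarrow> W \<in> sets N \<Longrightarrow> W \<inter> Z y = {} \<Longrightarrow> prob W > 0 \<Longrightarrow> \<nu> W y > 0"
    by metis
  have ZM: "Z y \<in> sets M" if "y \<in> Y" for y using ZN that NM by blast
  \<comment> \<open>The events at stake lie in the past \<open>\<sigma>\<close>-algebra, so a general \<open>W\<close> can be traded for a level set of
    its conditional expectation.\<close>
  have ZposM: "\<nu> W y > 0" if y: "y \<in> Y" and W: "W \<in> sets M" "W \<inter> Z y = {}" "prob W > 0" for y W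
  proof -
    define w where "w = real_cond_exp M generated (indicator W)"
    have w_meas [measurable]: "w \<in> borel_measurable generated" by (simp add: w_def)
    have w_measM [measurable]: "w \<in> borel_measurable M" by (simp add: w_def)
    have w01: "AE x in M. 0 \<le> w x \<and> w x \<le> 1"
    proof -
      have "AE x in M. w x \<ge> 0" unfolding w_def
        using W(1) by (intro C.real_cond_exp_ge_c) (auto simp: less_top[symmetric])
      moreover have "AE x in M. w x \<le> 1" unfolding w_def
        using W(1) by (intro C.real_cond_exp_le_c) (auto simp: less_top[symmetric] indicator_def)
      ultimately show ?thesis by auto
    qed
    have int_w: "integrable M w" unfolding w_def using W(1)
      by (intro C.real_cond_exp_int) (auto simp: less_top[symmetric])
    have wE: "prob (W \<inter> E) = (\<integral>x. indicator E x * w x \<partial>M)" if "E \<in> sets N" for E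
    proof -
      have "(\<integral>x\<in>E. (indicator W x :: real) \<partial>M) = (\<integral>x\<in>E. w x \<partial>M)"
        unfolding w_def using that W(1) by (intro C.real_cond_exp_intA) (auto simp: setsN less_top[symmetric])
      moreover have "(\<integral>x\<in>E. (indicator W x :: real) \<partial>M) = (\<integral>x. (indicator (W \<inter> E) x :: real) \<partial>M)"
        unfolding set_lebesgue_integral_def by (intro Bochner_Integration.integral_cong) (auto simp: indicator_def)
      moreover have "\<dots> = prob (W \<inter> E)" using W(1) NM[OF that] by simp
      ultimately show ?thesis by (simp add: set_lebesgue_integral_def)
    qed
    \<comment> \<open>Since \<open>w \<le> 1\<close>, the integral of \<open>w\<close> off
      \<open>Z y\<close>, which is \<open>prob W\<close>, is at most \<open>t + prob T\<close>.
      Taking half of \<open>prob W\<close> for \<open>t\<close> leaves \<open>T\<close> with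
      positive measure.\<close>
    define t where "t = prob W / 2"
    have t: "t > 0" using W by (simp add: t_def)
    define T where "T = {x \<in> space M. w x \<ge> t} - Z y"
    have TN: "T \<in> sets N"
    proof -
      have "{x \<in> space generated. w x \<ge> t} \<in> sets generated" by measurable
      then show ?thesis using ZN[OF y] by (auto simp: T_def setsN)
    qed
    have TM: "T \<in> sets M" by (rule NM[OF TN])
    have spN: "space M - Z y \<in> sets N" 
      using sets.compl_sets[OF ZN[OF y]] by (simp add: N_def space_restr_to_subalg)
    have "prob W = prob (W \<inter> (space M - Z y))"
      using W(2) sets.sets_into_space[OF W(1)] by (intro arg_cong[of _ _ prob]) auto
    also have "\<dots> = (\<integral>x. indicator (space M - Z y) x * w x \<partial>M)" by (rule wE[OF spN])
    also have "\<dots> \<le> (\<integral>x. t + indicator T x \<partial>M)"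
    proof (rule integral_mono_AE)
      show "integrable M (\<lambda>x. indicator (space M - Z y) x * w x)"
        using integrable_mult_indicator[OF NM[OF spN] int_w] by simp
      show "integrable M (\<lambda>x. t + indicator T x)"
        using TM by (auto simp: less_top[symmetric])
      show "AE x in M. indicator (space M - Z y) x * w x \<le> t + indicator T x"
        using w01 by eventually_elim (use t in \<open>auto simp: indicator_def T_def\<close>)
    qed
    also have "\<dots> = t + prob T" using TM by (simp add: prob_space less_top[symmetric])
    finally have T_pos: "prob T > 0" using t by (simp add: t_def)
    \<comment> \<open>On \<open>T\<close> the conditional expectation is at least \<open>t\<close>,
      and \<open>T \<inter> fib i y\<close> is itself a past event, so \<open>W\<close> fills at
      least the fraction \<open>t\<close> of it.\<close>
    have "t * \<nu> T y \<le> \<nu> W y"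
    proof (rule tendsto_le[OF F(1)])
      show "((\<lambda>i. t * prob (T \<inter> fib i y)) \<longlongrightarrow> t * \<nu> T y) F"
        using \<nu>'[OF TM y] by (intro tendsto_intros)
      show "((\<lambda>i. prob (W \<inter> fib i y)) \<longlongrightarrow> \<nu> W y) F" using \<nu>'[OF W(1) y] .
      have "t * prob (T \<inter> fib i y) \<le> prob (W \<inter> fib i y)" for i
      proof -
        have TfN: "T \<inter> fib i y \<in> sets N" using TN fibN[OF y] by auto
        have "t * prob (T \<inter> fib i y) = (\<integral>x. t * indicator (T \<inter> fib i y) x \<partial>M)"
          using NM[OF TfN] by simp
        also have "\<dots> \<le> (\<integral>x. indicator (T \<inter> fib i y) x * w x \<partial>M)"
        proof (rule integral_mono)
          show "integrable M (\<lambda>x. t * indicator (T \<inter> fib i y) x)"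
            using NM[OF TfN] by (auto simp: less_top[symmetric])
          show "integrable M (\<lambda>x. indicator (T \<inter> fib i y) x * w x)"
            using integrable_mult_indicator[OF NM[OF TfN] int_w] by simp
        qed (auto simp: indicator_def T_def)
        also have "\<dots> = prob (W \<inter> (T \<inter> fib i y))" by (rule wE[OF TfN, symmetric])
        also have "\<dots> \<le> prob (W \<inter> fib i y)"
          using W(1) fib[OF y] by (intro finite_measure_mono) auto
        finally show ?thesis .
      qed
      then show "eventually (\<lambda>i. t * prob (T \<inter> fib i y) \<le> prob (W \<inter> fib i y)) F" by simp
    qed
    moreover have "\<nu> T y > 0" using T_pos TN y by (intro Zpos) (auto simp: T_def)
    ultimately show ?thesis using t by (meson less_le_trans mult_pos_pos)
  qed
  define YS where "YS S = {x \<in> space M. {y \<in> Y. x \<notin> Z y} = S}" for S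
  have YS_sets: "YS S \<in> sets M" if "S \<subseteq> Y" for S
  proof -
    have "YS S = space M \<inter> ((space M - (\<Union>y\<in>S. Z y)) - (\<Union>y\<in>Y - S. space M - Z y))"
      using that by (auto simp: YS_def)
    moreover have "(\<Union>y\<in>S. Z y) \<in> sets M"
      using that ZM finite_subset[OF that finite_Y] by (intro sets.finite_UN) auto
    moreover have "(\<Union>y\<in>Y - S. space M - Z y) \<in> sets M"
    proof (rule sets.finite_UN)
      show "space M - Z y \<in> sets M" if "y \<in> Y - S" for y using ZM that by auto
    qed (use finite_Y in auto)
    ultimately show ?thesis by auto
  qed
  \<comment> \<open>Points of \<open>YS S\<close> avoid the zero set of each symbol in
    \<open>S\<close>, so positive measure would let \<open>ZposM\<close> contradict
    \<open>few\<close>.\<close>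
  have YS0: "prob (YS S) = 0" if S: "S \<subseteq> Y" "card S > k" for S
  proof (rule ccontr)
    assume "prob (YS S) \<noteq> 0"
    then have "prob (YS S) > 0" by (simp add: zero_less_measure_iff)
    from few[OF S YS_sets[OF S(1)] this] obtain W y where
      W: "W \<in> sets M" "W \<subseteq> YS S" "prob W > 0" "y \<in> S" "\<nu> W y \<le> 0" by blast
    have "\<nu> W y > 0" using W S by (intro ZposM) (auto simp: YS_def)
    then show False using W by simp
  qed
  define big where "big = (\<Union>S\<in>{S. S \<subseteq> Y \<and> card S > k}. YS S)"
  have finPow: "finite {S. S \<subseteq> Y \<and> card S > k}" using finite_Y by simp
  have big_sets: "big \<in> sets M" unfolding big_def using YS_sets finPow by (intro sets.finite_UN) auto
  have "prob big \<le> (\<Sum>S\<in>{S. S \<subseteq> Y \<and> card S > k}. prob (YS S))"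
    unfolding big_def using finPow YS_sets by (intro finite_measure_subadditive_finite) auto
  then have big0: "prob big \<le> 0" using YS0 by simp

  have cY: "card Y > 0" using finite_Y Y_nonempty by (simp add: card_gt_0_iff)
  \<comment> \<open>The mixing weight is chosen so that \<open>- ln (1 - q) = e / 2\<close>; the
    other half of \<open>e\<close> is kept for mispredictions.\<close>
  define q where "q = 1 - exp (- e / 2)"
  have q: "0 < q" "q < 1" using e by (auto simp: q_def)
  have lnq: "- ln ((1 - q) / k) = ln k + e / 2" using k by (simp add: q_def ln_div)
  define b where "b = ln (card Y / q)"
  have b: "b \<ge> 0" using q cY by (simp add: b_def)
  \<comment> \<open>Chosen so that an error of \<open>2 * \<delta>\<close> per symbol, weighted by
    the penalty \<open>b\<close>, costs at most \<open>e / 2\<close>.\<close>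
  define \<delta> where "\<delta> = e / 2 / (b + 1) / (2 * card Y)"
  have \<delta>: "\<delta> > 0" using e b cY by (simp add: \<delta>_def)
  have \<delta>b: "b * (2 * card Y * \<delta>) \<le> e / 2"
  proof -
    have "b * (2 * card Y * \<delta>) = e / 2 * (b / (b + 1))" using cY by (simp add: \<delta>_def)
    also have "\<dots> \<le> e / 2 * 1" using b e by (intro mult_left_mono) auto
    finally show ?thesis by simp
  qed
  have "\<forall>y. \<exists>m E. y \<in> Y \<longrightarrow> determined m E \<and> prob ((Z y - E) \<union> (E - Z y)) < \<delta>"
    using generated_approx ZN \<delta> unfolding setsN by blast
  then obtain m E where E: "\<And>y. y \<in> Y \<Longrightarrow> determined (m y) (E y)"
    "\<And>y. y \<in> Y \<Longrightarrow> prob ((Z y - E y) \<union> (E y - Z y)) < \<delta>" by metis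
  have Es: "E y \<in> sets M" if "y \<in> Y" for y using E(1) that determined_sets by blast
  define n0 where "n0 = (\<Sum>y\<in>Y. m y)"
  have E0: "determined n (E y)" if "y \<in> Y" "n \<ge> n0" for n y
  proof (rule determined_mono[OF E(1)[OF that(1)]])
    have "m y \<le> n0" unfolding n0_def using that finite_Y by (intro member_le_sum) auto
    then show "m y \<le> n" using that by simp
  qed
  \<comment> \<open>The default \<open>{}\<close> keeps \<open>card (S x) \<le> k\<close> at every
    point. Outside \<open>big\<close> and the sets \<open>D y\<close> below, the first branch
    applies and lists exactly the \<open>y\<close> with \<open>x \<notin> Z y\<close>.\<close>
  define S where "S x = (if card {y \<in> Y. x \<notin> E y} \<le> k then {y \<in> Y. x \<notin> E y} else {})" for x
  have bound: "block_entropy (Suc n) \<le> block_entropy n + (ln k + e)"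
    if n: "n \<ge> n0" and small: "\<forall>y\<in>Y. prob (Z y \<inter> fib n y) < \<delta>" for n
  proof -
    define bad where "bad = {x \<in> space M. \<xi> (Suc n) x \<notin> S x}"
    have "block_entropy (Suc n) \<le> block_entropy n - ln ((1 - q) / k) + b * prob bad"
      unfolding b_def bad_def
    proof (rule block_entropy_increment[OF k q])
      fix x x' assume x: "x \<in> space M" "x' \<in> space M" "\<And>i. i \<in> {1..n} \<Longrightarrow> \<xi> i x = \<xi> i x'"
      have "x \<in> E y \<longleftrightarrow> x' \<in> E y" if "y \<in> Y" for y
        using E0[OF that n] x unfolding determined_def by metis
      then have "{y \<in> Y. x \<notin> E y} = {y \<in> Y. x' \<notin> E y}" by auto
      then show "S x = S x'" by (simp add: S_def)
    qed (auto simp: S_def)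
    also have "b * prob bad \<le> e / 2"
    proof -
      \<comment> \<open>The two sources of error for the symbol \<open>y\<close>: \<open>E y\<close>
        differs from \<open>Z y\<close>, or \<open>y\<close> occurs next although the point lies in
        \<open>Z y\<close>.\<close>
      define D where "D y = ((Z y - E y) \<union> (E y - Z y)) \<union> (Z y \<inter> fib n y)" for y
      have Ds: "D y \<in> sets M" if "y \<in> Y" for y using ZM Es fib that by (auto simp: D_def)
      have Dp: "prob (D y) \<le> 2 * \<delta>" if "y \<in> Y" for y
      proof -
        have "prob (D y) \<le> prob ((Z y - E y) \<union> (E y - Z y)) + prob (Z y \<inter> fib n y)"
          unfolding D_def using ZM Es fib that by (intro measure_Un_le) auto
        then show ?thesis using E(2)[OF that] small that by force
      qed
      have "bad \<subseteq> big \<union> (\<Union>y\<in>Y. D y)"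
      proof
        fix x assume x: "x \<in> bad"
        show "x \<in> big \<union> (\<Union>y\<in>Y. D y)"
        proof (rule ccontr)
          assume no: "x \<notin> big \<union> (\<Union>y\<in>Y. D y)"
          have xs: "x \<in> space M" using x by (simp add: bad_def)
          have eq: "{y \<in> Y. x \<notin> E y} = {y \<in> Y. x \<notin> Z y}" using no by (auto simp: D_def)
          have "x \<in> YS {y \<in> Y. x \<notin> Z y}" using xs by (simp add: YS_def)
          then have "card {y \<in> Y. x \<notin> Z y} \<le> k"
            using no unfolding big_def by (metis (no_types, lifting) Un_iff UN_I linorder_not_less mem_Collect_eq subsetI)
          then have "S x = {y \<in> Y. x \<notin> Z y}" by (simp add: S_def eq)
          then have "x \<in> Z (\<xi> (Suc n) x)" using x in_Y[OF xs] by (auto simp: bad_def)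
          then have "x \<in> D (\<xi> (Suc n) x)" using xs by (simp add: D_def fib_def)
          then show False using no in_Y[OF xs] by blast
        qed
      qed
      then have "prob bad \<le> prob (big \<union> (\<Union>y\<in>Y. D y))"
        using big_sets Ds finite_Y by (intro finite_measure_mono) (auto intro!: sets.finite_UN)
      also have "\<dots> \<le> prob big + prob (\<Union>y\<in>Y. D y)"
        using big_sets Ds finite_Y by (intro measure_Un_le) (auto intro!: sets.finite_UN)
      also have "prob (\<Union>y\<in>Y. D y) \<le> (\<Sum>y\<in>Y. prob (D y))"
        using Ds finite_Y by (intro finite_measure_subadditive_finite) auto
      also have "\<dots> \<le> (\<Sum>y\<in>Y. 2 * \<delta>)" using Dp by (intro sum_mono) auto
      also have "\<dots> = 2 * card Y * \<delta>" by simp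
      finally have "prob bad \<le> 2 * card Y * \<delta>" using big0 by simp
      then have "b * prob bad \<le> b * (2 * card Y * \<delta>)" using b by (intro mult_left_mono) auto
      then show ?thesis using \<delta>b by simp
    qed
    finally show ?thesis using lnq by simp
  qed
  have "eventually (\<lambda>i. prob (Z y \<inter> fib i y) < \<delta>) F" if "y \<in> Y" for y
    using \<nu>'[OF ZM[OF that] that] Z0[OF that] \<delta> by (intro order_tendstoD(2)) auto
  then have "eventually (\<lambda>i. \<forall>y\<in>Y. prob (Z y \<inter> fib i y) < \<delta>) F"
    using finite_Y by (intro eventually_ball_finite) auto
  moreover have "eventually (\<lambda>i. i \<ge> n0) F"
    using filter_leD[OF F(2) eventually_ge_at_top] .
  ultimately show ?thesis by eventually_elim (use bound in blast)
qed

end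

subsection \<open>Independence sets and IT tuples\<close>

text \<open>The sets with this property form a \<sigma>-algebra containing the closed sets: a closed
  set is the intersection of its open \<open>1 / Suc n\<close>-neighbourhoods, and complementation
  exchanges the roles of \<open>C\<close> and \<open>U\<close>.\<close>

lemma closed_open_sandwich:
  fixes M :: "'a::metric_space measure"
  assumes "finite_measure M" and sb: "sets M = sets borel" and "A \<in> sets borel" "e > 0"
  shows "\<exists>C U. closed C \<and> open U \<and> C \<subseteq> A \<and> A \<subseteq> U \<and> measure M (U - C) < e"
proof -
  interpret finite_measure M by fact
  have "A \<in> sigma_sets UNIV (Collect closed)"
    using assms(3) by (simp add: borel_eq_closed)
  then show ?thesis using \<open>e > 0\<close>
  proof (induction arbitrary: e)
    case (Basic A)
    then have cA: "closed A" by simp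
    show ?case
    \<comment> \<open>The empty set is separated because \<open>infdist x {}\<close> is 0 for every
      \<open>x\<close>.\<close>
    proof (cases "A = {}")
      case True
      then show ?thesis using Basic by (intro exI[of _ "{}"]) auto
    next
      case False
      define U where "U n = {x. infdist x A < 1 / real (Suc n)}" for n
      have oU: "open (U n)" for n
        unfolding U_def by (intro open_Collect_less continuous_intros)
      have AU: "A \<subseteq> U n" for n by (auto simp: U_def)
      have "(\<Inter>n. U n) \<subseteq> A"
      proof
        fix x assume x: "x \<in> (\<Inter>n. U n)"
        have "infdist x A \<le> 0"
        proof (rule LIMSEQ_le_const[OF LIMSEQ_Suc[OF lim_1_over_n]])
          show "\<exists>N. \<forall>n\<ge>N. infdist x A \<le> 1 / real (Suc n)"
            using x by (auto simp: U_def less_imp_le)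
        qed
        then show "x \<in> A" using in_closed_iff_infdist_zero[OF cA False] infdist_nonneg[of x A] by auto
      qed
      then have IU: "(\<Inter>n. U n - A) = {}" by auto
      have "(\<lambda>n. measure M (U n - A)) \<longlonglongrightarrow> measure M (\<Inter>n. U n - A)"
      proof (rule finite_Lim_measure_decseq)
        show "range (\<lambda>n. U n - A) \<subseteq> sets M" using oU cA by (auto simp: sb)
        show "decseq (\<lambda>n. U n - A)"
        proof (intro decseq_SucI)
          fix n
          have "1 / real (Suc (Suc n)) \<le> 1 / real (Suc n)" by (simp add: field_simps)
          then show "U (Suc n) - A \<subseteq> U n - A" unfolding U_def by (auto intro: less_le_trans)
        qed
      qed
      then have "(\<lambda>n. measure M (U n - A)) \<longlonglongrightarrow> 0" by (simp only: IU measure_empty)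
      then have "eventually (\<lambda>n. measure M (U n - A) < e) sequentially"
        using Basic.prems by (intro order_tendstoD(2))
      then obtain n where "measure M (U n - A) < e"
        using eventually_happens'[OF sequentially_bot] by blast
      then show ?thesis using oU AU cA by blast
    qed
  next
    case Empty
    then show ?case by (intro exI[of _ "{}"]) auto
  next
    case (Compl A)
    then obtain C U where *: "closed C" "open U" "C \<subseteq> A" "A \<subseteq> U" "measure M (U - C) < e" by metis
    have "(UNIV - C) - (UNIV - U) = U - C" by auto
    then show ?case using * by (intro exI[of _ "UNIV - U"] exI[of _ "UNIV - C"]) (auto simp: open_Diff closed_Diff)
  next
    case (Union A)
    have d: "e / 2 * (1/2) ^ Suc i > 0" for i using Union.prems by simp
    have "\<forall>i. \<exists>C U. closed C \<and> open U \<and> C \<subseteq> A i \<and> A i \<subseteq> U \<and> measure M (U - C) < e / 2 * (1/2) ^ Suc i"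
      using Union.IH[OF d] by (rule allI)
    from choice[OF this] obtain C where
      "\<forall>i. \<exists>U. closed (C i) \<and> open U \<and> C i \<subseteq> A i \<and> A i \<subseteq> U \<and> measure M (U - C i) < e / 2 * (1/2) ^ Suc i"
      by blast
    from choice[OF this] obtain U where
      CU: "\<And>i. closed (C i)" "\<And>i. open (U i)" "\<And>i. C i \<subseteq> A i" "\<And>i. A i \<subseteq> U i"
        "\<And>i. measure M (U i - C i) < e / 2 * (1/2) ^ Suc i"
      by blast
    have sU: "U i \<in> sets M" and sC: "C i \<in> sets M" for i using CU(1,2) by (auto simp: sb)
    define V where "V = (\<Union>i. U i)"
    have sums: "(\<lambda>i. e / 2 * (1/2) ^ Suc i) sums (e / 2 * 1)"
      by (rule sums_mult[OF power_half_series])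
    have summ: "summable (\<lambda>i. measure M (U i - C i))"
    proof (rule summable_comparison_test'[OF sums_summable[OF sums]])
      show "norm (measure M (U n - C n)) \<le> e / 2 * (1/2) ^ Suc n" if "n \<ge> 0" for n
        using CU(5)[of n] by simp
    qed
    have "measure M (V - (\<Union>i. C i)) \<le> measure M (\<Union>i. U i - C i)"
      using sU sC by (intro finite_measure_mono) (auto simp: V_def)
    also have "\<dots> \<le> (\<Sum>i. measure M (U i - C i))"
      using sU sC summ by (intro finite_measure_subadditive_countably) auto
    also have "\<dots> \<le> (\<Sum>i. e / 2 * (1/2) ^ Suc i)"
      using CU(5) summ sums_summable[OF sums] by (intro suminf_le) (auto intro: less_imp_le)
    also have "\<dots> = e / 2" using sums_unique[OF sums] by simp
    finally have le: "measure M (V - (\<Union>i. C i)) \<le> e / 2" .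
    \<comment> \<open>A countable union of closed sets need not be closed, so only finitely many
      \<open>C i\<close> are kept. The covers \<open>U i\<close> have used up \<open>e / 2\<close>;
      the truncation may use the rest.\<close>
    have "(\<lambda>N. measure M (V - (\<Union>i<N. C i))) \<longlonglongrightarrow> measure M (\<Inter>N. V - (\<Union>i<N. C i))"
    proof (rule finite_Lim_measure_decseq)
      show "range (\<lambda>N. V - (\<Union>i<N. C i)) \<subseteq> sets M" using sU sC by (auto simp: V_def)
      show "decseq (\<lambda>N. V - (\<Union>i<N. C i))" by (rule decseq_SucI) auto
    qed
    moreover have "(\<Inter>N. V - (\<Union>i<N. C i)) = V - (\<Union>i. C i)" by auto
    ultimately have "(\<lambda>N. measure M (V - (\<Union>i<N. C i))) \<longlonglongrightarrow> measure M (V - (\<Union>i. C i))"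
      by (simp only:)
    then have "eventually (\<lambda>N. measure M (V - (\<Union>i<N. C i)) < e) sequentially"
      using le Union.prems by (elim order_tendstoD(2)) auto
    then obtain N where N: "measure M (V - (\<Union>i<N. C i)) < e"
      using eventually_happens'[OF sequentially_bot] by blast
    have "closed (\<Union>i<N. C i)" using CU(1) by (intro closed_UN) auto
    moreover have "open V" using CU(2) by (auto simp: V_def)
    moreover have "(\<Union>i<N. C i) \<subseteq> (\<Union>i. A i)" using CU(3) by blast
    moreover have "(\<Union>i. A i) \<subseteq> V" using CU(4) unfolding V_def by blast
    ultimately show ?case using N by blast
  qed
qed

lemma closed_inner_approx:
  fixes M :: "'a::metric_space measure"
  assumes "finite_measure M" "sets M = sets borel" "A \<in> sets borel" "e > 0"
  shows "\<exists>C. closed C \<and> C \<subseteq> A \<and> measure M (A - C) < e"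
proof -
  obtain C U where *: "closed C" "open U" "C \<subseteq> A" "A \<subseteq> U" "measure M (U - C) < e"
    using closed_open_sandwich[OF assms] by blast
  have "measure M (A - C) \<le> measure M (U - C)"
    using * assms by (intro finite_measure.finite_measure_mono) auto
  then show ?thesis using * by force
qed

text \<open>Total boundedness gives a finite net for each radius \<open>1 / Suc n\<close>; the balls
  of these radii around the net points form the base.\<close>

lemma compact_countable_base:
  assumes "compact (UNIV :: 'a::metric_space set)"
  obtains \<B> :: "'a::metric_space set set" where "countable \<B>" "\<And>V. V \<in> \<B> \<Longrightarrow> open V"
    "\<And>x U. open U \<Longrightarrow> x \<in> U \<Longrightarrow> \<exists>V\<in>\<B>. x \<in> V \<and> V \<subseteq> U"
proof -
  have "\<forall>n. \<exists>C. finite C \<and> (UNIV :: 'a set) \<subseteq> (\<Union>c\<in>C. ball c (1 / real (Suc n)))"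
  proof
    fix n
    have "1 / real (Suc n) > 0" by simp
    moreover have "\<forall>e>0. \<exists>C. finite C \<and> (UNIV :: 'a set) \<subseteq> (\<Union>c\<in>C. ball c e)"
      by (rule conjunct2[OF iffD1[OF compact_eq_totally_bounded assms]])
    ultimately show "\<exists>C. finite C \<and> (UNIV :: 'a set) \<subseteq> (\<Union>c\<in>C. ball c (1 / real (Suc n)))"
      by (elim allE impE)
  qed
  from choice[OF this] obtain C
    where "\<forall>n. finite (C n) \<and> (UNIV :: 'a set) \<subseteq> (\<Union>c\<in>C n. ball c (1 / real (Suc n)))" ..
  then have C: "finite (C n)" "(UNIV :: 'a set) \<subseteq> (\<Union>c\<in>C n. ball c (1 / real (Suc n)))" for n
    by blast+
  define \<B> where "\<B> = (\<Union>n. (\<lambda>c. ball c (1 / real (Suc n))) ` C n)"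
  show ?thesis
  proof (rule that[of \<B>])
    show "countable \<B>" unfolding \<B>_def using C(1) by (auto intro: countable_finite)
    show "open V" if "V \<in> \<B>" for V using that by (auto simp: \<B>_def)
    fix x U assume "open U" "x \<in> (U :: 'a set)"
    then obtain r where r: "r > 0" "ball x r \<subseteq> U" using openE by blast
    obtain n where n: "1 / real (Suc n) < r / 2"
      using reals_Archimedean[of "r / 2"] r by (auto simp: inverse_eq_divide)
    obtain c where c: "c \<in> C n" "x \<in> ball c (1 / real (Suc n))" using C(2)[of n] by blast
    have "ball c (1 / real (Suc n)) \<subseteq> U"
    proof
      fix y assume "y \<in> ball c (1 / real (Suc n))"
      then have "dist x y < r" using c(2) n dist_triangle[of x y c] by (auto simp: dist_commute)
      then show "y \<in> U" using r(2) by auto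
    qed
    then show "\<exists>V\<in>\<B>. x \<in> V \<and> V \<subseteq> U" using c by (auto simp: \<B>_def)
  qed
qed

section \<open>From positive limits to independence sets and IT tuples\<close>

text \<open>Greedy construction: \<open>good J\<close> says that every pattern on \<open>J\<close>
  is realised on a subset of \<open>B\<close> of positive measure. There are finitely many patterns,
  so \<open>pos\<close> holds for all of them at one common \<open>i\<close>, and \<open>s i\<close>
  can be added to \<open>J\<close>.\<close>

lemma infinite_independence_set:
  fixes M :: "'x measure" and s :: "nat \<Rightarrow> 'g"
  assumes "finite_measure M" and sp: "space M = UNIV" and F: "F \<noteq> bot" and K: "K \<ge> 2"
    and D: "\<And>k. k \<in> {1..K} \<Longrightarrow> D k \<in> sets M"
    and disj: "\<And>k l. k \<in> {1..K} \<Longrightarrow> l \<in> {1..K} \<Longrightarrow> k \<noteq> l \<Longrightarrow> D k \<inter> D l = {}"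
    and meas: "\<And>g E. g \<in> carrier G \<Longrightarrow> E \<in> sets M \<Longrightarrow> \<phi> g -` E \<in> sets M"
    and s: "\<And>i. s i \<in> carrier G"
    and B: "B \<in> sets M" "measure M B > 0"
    and pos: "\<And>W k. W \<in> sets M \<Longrightarrow> W \<subseteq> B \<Longrightarrow> measure M W > 0 \<Longrightarrow> k \<in> {1..K} \<Longrightarrow>
      eventually (\<lambda>i. measure M (W \<inter> \<phi> (s i) -` D k) > 0) F"
  shows "\<exists>J. infinite J \<and> independence_set G \<phi> K D J"
proof -
  interpret finite_measure M by fact
  define E where "E J \<sigma> = B \<inter> {x. \<forall>g\<in>J. \<phi> g x \<in> D (\<sigma> g)}" for J \<sigma>
  define good where "good J \<longleftrightarrow> finite J \<and> J \<subseteq> carrier G \<and> (\<forall>\<sigma>\<in>J \<rightarrow> {1..K}. measure M (E J \<sigma>) > 0)" for J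
  have E_sets: "E J \<sigma> \<in> sets M" if "finite J" "J \<subseteq> carrier G" "\<sigma> \<in> J \<rightarrow> {1..K}" for J \<sigma>
  proof -
    have "{x \<in> space M. \<forall>g\<in>J. \<phi> g x \<in> D (\<sigma> g)} \<in> sets M"
    proof (intro sets.sets_Collect_finite_All that(1))
      fix g assume "g \<in> J"
      then have "\<phi> g -` D (\<sigma> g) \<in> sets M" using that by (intro meas D) auto
      then show "{x \<in> space M. \<phi> g x \<in> D (\<sigma> g)} \<in> sets M" by (simp add: sp vimage_def)
    qed
    then show ?thesis using B(1) by (auto simp: E_def sp)
  qed
  have E_cong: "E J \<sigma> = E J \<sigma>'" if "\<And>g. g \<in> J \<Longrightarrow> \<sigma> g = \<sigma>' g" for J \<sigma> \<sigma>'
    using that by (auto simp: E_def)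
  have step: "\<exists>J'. good J' \<and> J \<subset> J'" if J: "good J" for J
  proof -
    have "eventually (\<lambda>i. \<forall>\<sigma>\<in>J \<rightarrow>\<^sub>E {1..K}. \<forall>k\<in>{1..K}. measure M (E J \<sigma> \<inter> \<phi> (s i) -` D k) > 0) F"
    proof (intro eventually_ball_finite ballI)
      show "finite (J \<rightarrow>\<^sub>E {1..K})" using J by (intro finite_PiE) (auto simp: good_def)
      fix \<sigma> k assume *: "\<sigma> \<in> J \<rightarrow>\<^sub>E {1..K}" "k \<in> {1..K}"
      then have "\<sigma> \<in> J \<rightarrow> {1..K}" by auto
      then show "eventually (\<lambda>i. measure M (E J \<sigma> \<inter> \<phi> (s i) -` D k) > 0) F"
        using J * E_sets by (intro pos) (auto simp: good_def E_def)
    qed auto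
    then obtain i where i: "\<And>\<sigma> k. \<sigma> \<in> J \<rightarrow>\<^sub>E {1..K} \<Longrightarrow> k \<in> {1..K} \<Longrightarrow>
        measure M (E J \<sigma> \<inter> \<phi> (s i) -` D k) > 0"
      using eventually_happens'[OF F] by blast
    \<comment> \<open>An \<open>s i\<close> already in \<open>J\<close> would have to send a point
      into \<open>D 1\<close> and \<open>D 2\<close> at once; this is where two disjoint sets are
      required.\<close>
    have new: "s i \<notin> J"
    proof
      assume "s i \<in> J"
      define \<sigma> where "\<sigma> = restrict (\<lambda>_. 1::nat) J"
      have "measure M (E J \<sigma> \<inter> \<phi> (s i) -` D 2) > 0" using K by (intro i) (auto simp: \<sigma>_def)
      moreover have "E J \<sigma> \<inter> \<phi> (s i) -` D 2 = {}"
        using \<open>s i \<in> J\<close> disj[of 1 2] K by (auto simp: E_def \<sigma>_def)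
      ultimately show False by simp
    qed
    have "good (insert (s i) J)"
      unfolding good_def
    proof (intro conjI ballI)
      fix \<sigma> assume \<sigma>: "\<sigma> \<in> insert (s i) J \<rightarrow> {1..K}"
      have "measure M (E J (restrict \<sigma> J) \<inter> \<phi> (s i) -` D (\<sigma> (s i))) > 0"
        using \<sigma> by (intro i) auto
      moreover have "E J (restrict \<sigma> J) \<inter> \<phi> (s i) -` D (\<sigma> (s i)) = E (insert (s i) J) \<sigma>"
        by (auto simp: E_def)
      ultimately show "measure M (E (insert (s i) J) \<sigma>) > 0" by simp
    qed (use J s in \<open>auto simp: good_def\<close>)
    then show ?thesis using new by blast
  qed
  have "good {}" using B by (simp add: good_def E_def)
  then have "\<exists>f. \<forall>n. good (f n) \<and> f n \<subset> f (Suc n)"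
    using step by (intro dependent_nat_choice[of "\<lambda>_. good" "\<lambda>_ J J'. J \<subset> J'"]) blast+
  then obtain f where "\<forall>n. good (f n) \<and> f n \<subset> f (Suc n)" ..
  then have f: "good (f n)" "f n \<subset> f (Suc n)" for n by simp_all
  define J where "J = (\<Union>n. f n)"
  have mono: "f m \<subseteq> f n" if "m \<le> n" for m n
    using that
  proof (induction rule: dec_induct)
    case (step i)
    then show ?case using f(2)[of i] by blast
  qed simp
  have card: "n \<le> card (f n)" for n
  proof (induction n)
    case (Suc n)
    have "card (f n) < card (f (Suc n))" using f by (intro psubset_card_mono) (auto simp: good_def)
    then show ?case using Suc by simp
  qed simp
  have "infinite J"
  proof
    assume fin: "finite J"
    have "card (f (Suc (card J))) \<le> card J" using fin by (intro card_mono) (auto simp: J_def)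
    then show False using card[of "Suc (card J)"] by simp
  qed
  moreover have "independence_set G \<phi> K D J"
    unfolding independence_set_def
  proof (intro conjI allI impI ballI)
    show "J \<subseteq> carrier G" using f(1) by (auto simp: J_def good_def)
    fix I \<sigma> assume I: "I \<subseteq> J \<and> finite I \<and> I \<noteq> {}" and \<sigma>: "\<sigma> \<in> I \<rightarrow> {1..K}"
    have "\<forall>g\<in>I. \<exists>n. g \<in> f n" using I by (auto simp: J_def)
    then obtain m where m: "\<And>g. g \<in> I \<Longrightarrow> g \<in> f (m g)" by metis
    define n where "n = Max (m ` I)"
    have In: "I \<subseteq> f n"
    proof
      fix g assume "g \<in> I"
      then have "m g \<le> n" using I by (simp add: n_def)
      then show "g \<in> f n" using m[OF \<open>g \<in> I\<close>] mono by blast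
    qed
    \<comment> \<open>The pattern on \<open>I\<close> is extended to \<open>f n\<close> by the
      arbitrary value 1, since \<open>good\<close> speaks of patterns on all of
      \<open>f n\<close>.\<close>
    define \<sigma>' where "\<sigma>' g = (if g \<in> I then \<sigma> g else 1)" for g
    have "\<sigma>' \<in> f n \<rightarrow> {1..K}" using \<sigma> K by (auto simp: \<sigma>'_def)
    then have "measure M (E (f n) \<sigma>') > 0" using f(1)[of n] by (auto simp: good_def)
    then have "E (f n) \<sigma>' \<noteq> {}" by auto
    then obtain x where "x \<in> E (f n) \<sigma>'" by blast
    then have "x \<in> (\<Inter>g\<in>I. \<phi> g -` D (\<sigma> g))" using In by (force simp: E_def \<sigma>'_def)
    then show "(\<Inter>g\<in>I. \<phi> g -` D (\<sigma> g)) \<noteq> {}" by blast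
  qed
  ultimately show ?thesis by blast
qed

lemma independence_set_mono:
  assumes "independence_set G \<phi> K D J" "\<And>k. k \<in> {1..K} \<Longrightarrow> D k \<subseteq> U k"
  shows "independence_set G \<phi> K U J"
  unfolding independence_set_def
proof (intro conjI allI impI ballI)
  show "J \<subseteq> carrier G" using assms(1) by (simp add: independence_set_def)
  fix I \<sigma> assume I: "I \<subseteq> J \<and> finite I \<and> I \<noteq> {}" and \<sigma>: "\<sigma> \<in> I \<rightarrow> {1..K}"
  then have "(\<Inter>g\<in>I. \<phi> g -` D (\<sigma> g)) \<noteq> {}" using assms(1) unfolding independence_set_def by blast
  moreover have "(\<Inter>g\<in>I. \<phi> g -` D (\<sigma> g)) \<subseteq> (\<Inter>g\<in>I. \<phi> g -` U (\<sigma> g))"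
    using assms(2) \<sigma> by blast
  ultimately show "(\<Inter>g\<in>I. \<phi> g -` U (\<sigma> g)) \<noteq> {}" by blast
qed

text \<open>The atoms are shrunk to compact sets \<open>C k n\<close>, and compactness localises
  positivity at points \<open>y k\<close>: for all basic neighbourhoods \<open>V k\<close> of
  \<open>y k\<close>, the functions \<open>\<nu> _ (V k \<inter> C k (n k))\<close> are positive on
  all non-null subsets of a common set \<open>T V n\<close> of positive measure. There
  \<open>infinite_independence_set\<close> applies. The points are distinct because the atoms are
  disjoint.\<close>

lemma essential_IT_tuple_exists:
  fixes M :: "'x::metric_space measure" and s :: "nat \<Rightarrow> 'g" and \<nu> :: "'x set \<Rightarrow> 'x set \<Rightarrow> real"
  assumes compact: "compact (UNIV :: 'x set)" and fin: "finite_measure M" and sb: "sets M = sets borel"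
    and F: "F \<noteq> bot" and K: "K \<ge> 2"
    and meas: "\<And>g E. g \<in> carrier G \<Longrightarrow> E \<in> sets M \<Longrightarrow> \<phi> g -` E \<in> sets M"
    and inv: "\<And>g E. g \<in> carrier G \<Longrightarrow> E \<in> sets M \<Longrightarrow> measure M (\<phi> g -` E) = measure M E"
    and s: "\<And>i. s i \<in> carrier G"
    and lim: "\<And>W D. W \<in> sets M \<Longrightarrow> D \<in> sets M \<Longrightarrow>
      ((\<lambda>i. measure M (W \<inter> \<phi> (s i) -` D)) \<longlongrightarrow> \<nu> W D) F"
    and A: "\<And>k. k \<in> {1..K} \<Longrightarrow> A k \<in> sets M"
    and disj: "\<And>k l. k \<in> {1..K} \<Longrightarrow> l \<in> {1..K} \<Longrightarrow> k \<noteq> l \<Longrightarrow> A k \<inter> A l = {}"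
    and B: "B \<in> sets M" "measure M B > 0"
    and pos: "\<And>W k. W \<in> sets M \<Longrightarrow> W \<subseteq> B \<Longrightarrow> measure M W > 0 \<Longrightarrow> k \<in> {1..K} \<Longrightarrow> \<nu> W (A k) > 0"
  shows "\<exists>x. essential_tuple K x \<and> IT_tuple G \<phi> K x"
proof -
  interpret finite_measure M by fact
  have sp [simp]: "space M = UNIV" using sets_eq_imp_space_eq[OF sb] by simp
  have pre: "\<phi> (s i) -` D \<in> sets M" if "D \<in> sets M" for i D using that s meas by blast
  have nn: "0 \<le> \<nu> W D" if "W \<in> sets M" "D \<in> sets M" for W D
    using that F by (intro tendsto_lowerbound[OF lim]) auto
  have leW: "\<nu> W D \<le> measure M W" if "W \<in> sets M" "D \<in> sets M" for W D
    using that F pre by (intro tendsto_upperbound[OF lim]) (auto intro!: always_eventually finite_measure_mono)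
  \<comment> \<open>Invariance enters here: the preimages of a small \<open>D\<close> are uniformly
    small.\<close>
  have leD: "\<nu> W D \<le> measure M D" if "W \<in> sets M" "D \<in> sets M" for W D
  proof (rule tendsto_upperbound[OF lim[OF that] _ F])
    have "measure M (W \<inter> \<phi> (s i) -` D) \<le> measure M D" for i
      using inv[OF s that(2), of i] that pre by (metis finite_measure_mono inf_le2)
    then show "eventually (\<lambda>i. measure M (W \<inter> \<phi> (s i) -` D) \<le> measure M D) F" by simp
  qed
  have monoW: "\<nu> W D \<le> \<nu> W' D" if "W \<in> sets M" "W' \<in> sets M" "D \<in> sets M" "W \<subseteq> W'" for W W' D
    using that pre by (intro tendsto_le[OF F lim lim] always_eventually allI finite_measure_mono) auto
  have subW: "\<nu> (W \<union> W') D \<le> \<nu> W D + \<nu> W' D" if "W \<in> sets M" "W' \<in> sets M" "D \<in> sets M" for W W' D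
  proof (rule tendsto_le[OF F])
    show "((\<lambda>i. measure M ((W \<union> W') \<inter> \<phi> (s i) -` D)) \<longlongrightarrow> \<nu> (W \<union> W') D) F" using that by (intro lim) auto
    show "((\<lambda>i. measure M (W \<inter> \<phi> (s i) -` D) + measure M (W' \<inter> \<phi> (s i) -` D)) \<longlongrightarrow> \<nu> W D + \<nu> W' D) F"
      using that by (intro tendsto_intros lim)
    show "eventually (\<lambda>i. measure M ((W \<union> W') \<inter> \<phi> (s i) -` D) \<le>
        measure M (W \<inter> \<phi> (s i) -` D) + measure M (W' \<inter> \<phi> (s i) -` D)) F"
      using that pre by (auto simp: Int_Un_distrib2 intro!: always_eventually measure_Un_le)
  qed
  have subD: "\<nu> W D \<le> (\<Sum>V\<in>\<V>. \<nu> W (f V))"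
    if "finite \<V>" "W \<in> sets M" "D \<in> sets M" "\<And>V. V \<in> \<V> \<Longrightarrow> f V \<in> sets M" "D \<subseteq> (\<Union>V\<in>\<V>. f V)"
    for W D \<V> and f :: "'v \<Rightarrow> 'x set"
  proof (rule tendsto_le[OF F _ lim[OF that(2,3)]])
    show "((\<lambda>i. \<Sum>V\<in>\<V>. measure M (W \<inter> \<phi> (s i) -` f V)) \<longlongrightarrow> (\<Sum>V\<in>\<V>. \<nu> W (f V))) F"
      using that by (intro tendsto_sum lim)
    have "measure M (W \<inter> \<phi> (s i) -` D) \<le> (\<Sum>V\<in>\<V>. measure M (W \<inter> \<phi> (s i) -` f V))" for i
    proof -
      have "measure M (W \<inter> \<phi> (s i) -` D) \<le> measure M (\<Union>V\<in>\<V>. W \<inter> \<phi> (s i) -` f V)"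
      proof (rule finite_measure_mono)
        show "W \<inter> \<phi> (s i) -` D \<subseteq> (\<Union>V\<in>\<V>. W \<inter> \<phi> (s i) -` f V)" using that(5) by blast
      qed (use that pre in \<open>auto intro!: sets.finite_UN\<close>)
      also have "\<dots> \<le> (\<Sum>V\<in>\<V>. measure M (W \<inter> \<phi> (s i) -` f V))"
        using that pre by (intro finite_measure_subadditive_finite) auto
      finally show ?thesis .
    qed
    then show "eventually (\<lambda>i. measure M (W \<inter> \<phi> (s i) -` D) \<le> (\<Sum>V\<in>\<V>. measure M (W \<inter> \<phi> (s i) -` f V))) F"
      by simp
  qed
  have "\<exists>Z. Z \<in> sets M \<and> \<nu> Z D = 0 \<and> (\<forall>W\<in>sets M. W \<inter> Z = {} \<longrightarrow> measure M W > 0 \<longrightarrow> \<nu> W D > 0)"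
    if "D \<in> sets M" for D
    by (rule zero_set_exists[of "\<lambda>W. \<nu> W D"]) (use that nn leW subW in auto)
  then obtain Z where Z: "\<And>D. D \<in> sets M \<Longrightarrow> Z D \<in> sets M" "\<And>D. D \<in> sets M \<Longrightarrow> \<nu> (Z D) D = 0"
    and Zpos: "\<And>D W. D \<in> sets M \<Longrightarrow> W \<in> sets M \<Longrightarrow> W \<inter> Z D = {} \<Longrightarrow> measure M W > 0 \<Longrightarrow> \<nu> W D > 0"
    by metis
  have in_Z: "\<nu> W D = 0" if "W \<in> sets M" "D \<in> sets M" "W \<subseteq> Z D" for W D
    using monoW[of W "Z D" D] Z[of D] nn[of W D] that by auto
  have AE_notin: "AE x in M. x \<notin> R" if "R \<in> sets M" "\<not> measure M R > 0" for R
  proof -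
    have "emeasure M R = 0" using that by (simp add: emeasure_eq_measure zero_less_measure_iff)
    then have "R \<in> null_sets M" using that by auto
    then show ?thesis by (rule AE_not_in)
  qed
  have "\<exists>C. closed C \<and> C \<subseteq> A k \<and> measure M (A k - C) < 1 / real (Suc n)" if "k \<in> {1..K}" for k n
    using A[OF that] by (intro closed_inner_approx[OF fin sb]) (auto simp: sb)
  then obtain C where C: "\<And>k n. k \<in> {1..K} \<Longrightarrow> closed (C k n)" "\<And>k n. k \<in> {1..K} \<Longrightarrow> C k n \<subseteq> A k"
    "\<And>k n. k \<in> {1..K} \<Longrightarrow> measure M (A k - C k n) < 1 / real (Suc n)" by metis
  have Cs: "C k n \<in> sets M" if "k \<in> {1..K}" for k n using C(1)[OF that] by (auto simp: sb)
  obtain \<B> :: "'x set set" where \<B>: "countable \<B>" "\<And>V. V \<in> \<B> \<Longrightarrow> open V"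
    "\<And>x U. open U \<Longrightarrow> x \<in> U \<Longrightarrow> \<exists>V\<in>\<B>. x \<in> V \<and> V \<subseteq> U"
    using compact_countable_base[OF compact] by metis
  have \<B>s: "V \<in> sets M" if "V \<in> \<B>" for V using \<B>(2)[OF that] by (auto simp: sb)
  have VC: "V \<inter> C k n \<in> sets M" if "V \<in> \<B>" "k \<in> {1..K}" for V k n using \<B>s Cs that by auto

  \<comment> \<open>All the points \<open>y k\<close> are read off one \<open>x \<in> B\<close> that avoids countably many null sets: \<open>x \<notin> Z D\<close> plays the
    role of a positive density of \<open>\<nu> _ D\<close> at \<open>x\<close>.\<close>
  have 1: "AE x in M. \<forall>k\<in>{1..K}. x \<in> B \<longrightarrow> (\<exists>n. x \<notin> Z (C k n))"
  proof (intro AE_ball_countable' countable_finite)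
    fix k assume k: "k \<in> {1..K}"
    define R where "R = B \<inter> (\<Inter>n. Z (C k n))"
    have R: "R \<in> sets M" using B(1) Z(1)[OF Cs[OF k]] by (auto simp: R_def)
    have "\<not> measure M R > 0"
    proof
      assume "measure M R > 0"
      then have p: "\<nu> R (A k) > 0" using R k by (intro pos) (auto simp: R_def)
      \<comment> \<open>On \<open>R\<close> every \<open>C k n\<close> has limit 0, so
        \<open>\<nu> R (A k)\<close> is bounded by the measure of \<open>A k - C k n\<close>, which
        is arbitrarily small.\<close>
      have "\<nu> R (A k) \<le> 1 / real (Suc n)" for n
      proof -
        have "\<nu> R (A k) \<le> (\<Sum>b\<in>{True, False}. \<nu> R (if b then C k n else A k - C k n))"
          using R A[OF k] Cs[OF k] by (intro subD) auto
        also have "\<dots> = \<nu> R (C k n) + \<nu> R (A k - C k n)" by simp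
        also have "\<nu> R (C k n) = 0" using R Cs[OF k] by (intro in_Z) (auto simp: R_def)
        also have "\<nu> R (A k - C k n) \<le> measure M (A k - C k n)" using R A[OF k] Cs[OF k] by (intro leD) auto
        finally show ?thesis using C(3)[OF k, of n] by simp
      qed
      then have "\<nu> R (A k) \<le> 0" using LIMSEQ_le_const[OF LIMSEQ_Suc[OF lim_1_over_n]] by blast
      then show False using p by simp
    qed
    then have "AE x in M. x \<notin> R" using R by (intro AE_notin)
    then show "AE x in M. x \<in> B \<longrightarrow> (\<exists>n. x \<notin> Z (C k n))" by eventually_elim (auto simp: R_def)
  qed auto
  \<comment> \<open>Only finite subfamilies of the countable base occur, so countably many null sets
    are discarded; compactness of \<open>C k n\<close> will reduce arbitrary basic covers to
    these.\<close>
  have 2: "AE x in M. \<forall>\<V>\<in>{\<V>. \<V> \<subseteq> \<B> \<and> finite \<V>}. \<forall>k\<in>{1..K}. \<forall>n\<in>UNIV. C k n \<subseteq> \<Union>\<V> \<longrightarrow>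
      x \<notin> Z (C k n) \<longrightarrow> (\<exists>V\<in>\<V>. x \<notin> Z (V \<inter> C k n))"
  proof (intro AE_ball_countable')
    fix \<V> k n assume \<V>: "\<V> \<in> {\<V>. \<V> \<subseteq> \<B> \<and> finite \<V>}" and k: "k \<in> {1..K}"
    show "AE x in M. C k n \<subseteq> \<Union>\<V> \<longrightarrow> x \<notin> Z (C k n) \<longrightarrow> (\<exists>V\<in>\<V>. x \<notin> Z (V \<inter> C k n))"
    proof (cases "C k n \<subseteq> \<Union>\<V>")
      case True
      define R where "R = {x \<in> space M. \<forall>V\<in>\<V>. x \<in> Z (V \<inter> C k n)} - Z (C k n)"
      have "{x \<in> space M. \<forall>V\<in>\<V>. x \<in> Z (V \<inter> C k n)} \<in> sets M"
      proof (intro sets.sets_Collect_finite_All)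
        fix V assume "V \<in> \<V>"
        then show "{x \<in> space M. x \<in> Z (V \<inter> C k n)} \<in> sets M" using Z(1) VC \<V> k by auto
      qed (use \<V> in auto)
      then have R: "R \<in> sets M" using Z(1) Cs[OF k] by (auto simp: R_def)
      have "\<not> measure M R > 0"
      proof
        assume "measure M R > 0"
        then have "\<nu> R (C k n) > 0" using R Cs[OF k] by (intro Zpos) (auto simp: R_def)
        moreover have "\<nu> R (C k n) \<le> (\<Sum>V\<in>\<V>. \<nu> R (V \<inter> C k n))"
          using R Cs[OF k] \<V> VC k True by (intro subD) auto
        moreover have "\<nu> R (V \<inter> C k n) = 0" if "V \<in> \<V>" for V
          using R VC \<V> k that by (intro in_Z) (auto simp: R_def)
        ultimately show False by simp
      qed
      then have "AE x in M. x \<notin> R" using R by (intro AE_notin)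
      then show ?thesis by eventually_elim (auto simp: R_def)
    qed simp
  qed (use countable_Collect_finite_subset[OF \<B>(1)] in \<open>auto simp: conj_commute\<close>)
  \<comment> \<open>The part of \<open>B\<close> that avoids all \<open>K\<close> zero sets of one
    choice of basic sets and closed sets; it takes over the role of \<open>B\<close> in the
    construction of the independence set.\<close>
  define T where "T V n = B - (\<Union>k\<in>{1..K}. Z (V k \<inter> C k (n k)))" for V n
  have Ts: "T V n \<in> sets M" if "V \<in> {1..K} \<rightarrow>\<^sub>E \<B>" for V n
    unfolding T_def using B(1) Z(1)[OF VC] PiE_mem[OF that] by (intro sets.Diff sets.finite_UN) auto
  \<comment> \<open>Extensional functions on \<open>{1..K}\<close> keep the set of choices
    countable, so all null sets \<open>T V n\<close> can be avoided at once.\<close>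
  have 3: "AE x in M. \<forall>V\<in>{1..K} \<rightarrow>\<^sub>E \<B>. \<forall>n\<in>{1..K} \<rightarrow>\<^sub>E (UNIV::nat set). x \<in> T V n \<longrightarrow> measure M (T V n) > 0"
  proof (intro AE_ball_countable' countable_PiE)
    fix V and n :: "nat \<Rightarrow> nat" assume "V \<in> {1..K} \<rightarrow>\<^sub>E \<B>"
    then show "AE x in M. x \<in> T V n \<longrightarrow> measure M (T V n) > 0"
      using AE_notin[OF Ts, of V n] by (cases "measure M (T V n) > 0") auto
  qed (use \<B>(1) in auto)
  have pick: "\<exists>x. x \<in> B \<and> P x" if AE: "AE x in M. P x" for P
  proof (rule ccontr)
    assume no: "\<not> ?thesis"
    have "AE x in M. x \<notin> B" using AE by eventually_elim (use no in auto)
    then have "emeasure M B = 0"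
      using AE_iff_measurable[OF B(1), of "\<lambda>x. x \<notin> B"] by simp
    then show False using B(2) by (simp add: measure_def)
  qed
  from pick[OF AE_conjI[OF 1 AE_conjI[OF 2 3]]] obtain x where
    xB: "x \<in> B" and P1: "\<forall>k\<in>{1..K}. x \<in> B \<longrightarrow> (\<exists>n. x \<notin> Z (C k n))" and
    P2: "\<forall>\<V>\<in>{\<V>. \<V> \<subseteq> \<B> \<and> finite \<V>}. \<forall>k\<in>{1..K}. \<forall>n\<in>UNIV. C k n \<subseteq> \<Union>\<V> \<longrightarrow>
      x \<notin> Z (C k n) \<longrightarrow> (\<exists>V\<in>\<V>. x \<notin> Z (V \<inter> C k n))" and
    P3: "\<forall>V\<in>{1..K} \<rightarrow>\<^sub>E \<B>. \<forall>n\<in>{1..K} \<rightarrow>\<^sub>E (UNIV::nat set). x \<in> T V n \<longrightarrow> measure M (T V n) > 0"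
    by (elim exE conjE)
  have "\<forall>k\<in>{1..K}. \<exists>n. x \<notin> Z (C k n)" using P1 xB by blast
  from bchoice[OF this] obtain n0 where n0: "\<And>k. k \<in> {1..K} \<Longrightarrow> x \<notin> Z (C k (n0 k))" by blast
  define n where "n = restrict n0 {1..K}"
  have n: "\<And>k. k \<in> {1..K} \<Longrightarrow> x \<notin> Z (C k (n k))" using n0 by (simp add: n_def)
  \<comment> \<open>Otherwise the basic \<open>V\<close> with
    \<open>x \<in> Z (V \<inter> C k (n k))\<close> cover this compact set, and a finite subcover
    contradicts \<open>P2\<close>.\<close>
  have "\<exists>y\<in>C k (n k). \<forall>V\<in>\<B>. y \<in> V \<longrightarrow> x \<notin> Z (V \<inter> C k (n k))" if k: "k \<in> {1..K}" for k
  proof (rule ccontr)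
    assume "\<not> ?thesis"
    then have cov: "C k (n k) \<subseteq> \<Union>{V \<in> \<B>. x \<in> Z (V \<inter> C k (n k))}" by blast
    have "compact (C k (n k))"
      using compact_Int_closed[OF compact C(1)[OF k, of "n k"]] by simp
    then obtain \<V> where \<V>: "\<V> \<subseteq> {V \<in> \<B>. x \<in> Z (V \<inter> C k (n k))}" "finite \<V>" "C k (n k) \<subseteq> \<Union>\<V>"
      using cov \<B>(2) by (elim compactE) auto
    then show False using P2[rule_format, of \<V> k "n k"] n k by blast
  qed
  then obtain y where y: "\<And>k. k \<in> {1..K} \<Longrightarrow> y k \<in> C k (n k)"
    "\<And>k V. k \<in> {1..K} \<Longrightarrow> V \<in> \<B> \<Longrightarrow> y k \<in> V \<Longrightarrow> x \<notin> Z (V \<inter> C k (n k))" by metis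
  have "essential_tuple K y"
    unfolding essential_tuple_def
  proof (intro allI impI)
    fix i j assume "1 \<le> i \<and> i < j \<and> j \<le> K"
    then have "i \<in> {1..K}" "j \<in> {1..K}" "i \<noteq> j" by auto
    then show "y i \<noteq> y j" using y(1) C(2) disj by (metis IntI empty_iff subsetD)
  qed
  moreover have "IT_tuple G \<phi> K y"
    unfolding IT_tuple_def
  proof (intro allI impI)
    fix U assume U: "\<forall>k\<in>{1..K}. open (U k) \<and> y k \<in> U k"
    then have "\<forall>k\<in>{1..K}. \<exists>V\<in>\<B>. y k \<in> V \<and> V \<subseteq> U k" using \<B>(3) by blast
    then obtain V0 where V0: "\<And>k. k \<in> {1..K} \<Longrightarrow> V0 k \<in> \<B> \<and> y k \<in> V0 k \<and> V0 k \<subseteq> U k" by metis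
    define V where "V = restrict V0 {1..K}"
    have V: "\<And>k. k \<in> {1..K} \<Longrightarrow> V k \<in> \<B> \<and> y k \<in> V k \<and> V k \<subseteq> U k" "V \<in> {1..K} \<rightarrow>\<^sub>E \<B>"
      using V0 by (auto simp: V_def)
    \<comment> \<open>The same \<open>x\<close> serves every choice of neighbourhoods; by
      \<open>P3\<close> its membership alone gives \<open>T V n\<close> positive measure.\<close>
    have "x \<in> T V n" using xB y(2) V by (auto simp: T_def)
    then have Tp: "measure M (T V n) > 0" using V P3[rule_format, of V n] by (auto simp: n_def)
    define D where "D k = V k \<inter> C k (n k)" for k
    have Ds: "D k \<in> sets M" if "k \<in> {1..K}" for k using VC V(1) that by (auto simp: D_def)
    have "\<exists>J. infinite J \<and> independence_set G \<phi> K D J"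
    proof (rule infinite_independence_set[OF fin sp F K Ds _ meas s Ts[OF V(2)] Tp])
      show "D k \<inter> D l = {}" if "k \<in> {1..K}" "l \<in> {1..K}" "k \<noteq> l" for k l
        using disj[OF that] C(2) that unfolding D_def by blast
      fix W k assume W: "W \<in> sets M" "W \<subseteq> T V n" "measure M W > 0" and k: "k \<in> {1..K}"
      have "W \<inter> Z (D k) = {}" using W(2) k by (auto simp: T_def D_def)
      then have "\<nu> W (D k) > 0" using W k Ds by (intro Zpos)
      then show "eventually (\<lambda>i. measure M (W \<inter> \<phi> (s i) -` D k) > 0) F"
        using lim[OF W(1) Ds[OF k]] by (intro order_tendstoD(1))
    qed
    then obtain J where "infinite J" "independence_set G \<phi> K D J" by blast
    then show "\<exists>J. infinite J \<and> independence_set G \<phi> K U J"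
      using independence_set_mono[of G \<phi> K D J U] V(1) unfolding D_def by blast
  qed
  ultimately show ?thesis by blast
qed

subsection \<open>Sequence entropy\<close>

text \<open>Members of \<open>\<alpha>\<close> are measurable only for the completion and cover the
  space only up to a null set. Cores \<open>S A\<close> in \<open>sets M\<close> define the label
  \<open>a x\<close>, which agrees with membership off the null set.\<close>

lemma measurable_partition_labelling:
  assumes "prob_space M" "\<alpha> \<in> measurable_partitions M"
  obtains a N where "N \<in> null_sets M" "\<And>x. a x \<in> \<alpha>"
    "\<And>A. A \<in> \<alpha> \<Longrightarrow> {x \<in> space M. a x = A} \<in> sets M"
    "\<And>x A. x \<in> space M - N \<Longrightarrow> A \<in> \<alpha> \<Longrightarrow> x \<in> A \<longleftrightarrow> a x = A"
proof -
  interpret prob_space M by fact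
  interpret C: prob_space "completion M"
    by (intro prob_spaceI) (simp add: emeasure_space_1)
  have \<alpha>: "finite \<alpha>" "\<And>A. A \<in> \<alpha> \<Longrightarrow> A \<in> sets (completion M)" "disjoint \<alpha>"
    "measure (completion M) (\<Union>\<alpha>) = 1"
    using assms(2) by (auto simp: measurable_partitions_def)
  have "\<forall>A\<in>\<alpha>. \<exists>S N. S \<in> sets M \<and> N \<in> null_sets M \<and> S \<subseteq> A \<and> A \<subseteq> S \<union> N"
  proof
    fix A assume "A \<in> \<alpha>"
    from \<alpha>(2)[OF this] show "\<exists>S N. S \<in> sets M \<and> N \<in> null_sets M \<and> S \<subseteq> A \<and> A \<subseteq> S \<union> N"
      by (rule sets_completionE) blast
  qed
  then obtain S Nf where S: "\<And>A. A \<in> \<alpha> \<Longrightarrow> S A \<in> sets M" "\<And>A. A \<in> \<alpha> \<Longrightarrow> Nf A \<in> null_sets M"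
    "\<And>A. A \<in> \<alpha> \<Longrightarrow> S A \<subseteq> A" "\<And>A. A \<in> \<alpha> \<Longrightarrow> A \<subseteq> S A \<union> Nf A"
    by metis
  have un: "A = A'" if "A \<in> \<alpha>" "A' \<in> \<alpha>" "x \<in> A" "x \<in> A'" for x A A'
    using disjointD[OF \<alpha>(3) that(1,2)] that(3,4) by blast
  have "\<alpha> \<noteq> {}" using \<alpha>(4) by auto
  then obtain A0 where A0: "A0 \<in> \<alpha>" by blast
  \<comment> \<open>By disjointness the choice is unique; the default \<open>A0\<close> gives the
    points outside all cores a label in \<open>\<alpha>\<close> as well.\<close>
  define a where "a x = (if \<exists>A\<in>\<alpha>. x \<in> S A then SOME A. A \<in> \<alpha> \<and> x \<in> S A else A0)" for x
  have a_eq: "a x = A" if "A \<in> \<alpha>" "x \<in> S A" for x A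
  proof -
    have "(SOME A. A \<in> \<alpha> \<and> x \<in> S A) = A"
    proof (rule some_equality)
      show "A' = A" if "A' \<in> \<alpha> \<and> x \<in> S A'" for A'
        using that \<open>A \<in> \<alpha>\<close> \<open>x \<in> S A\<close> S(3) un by (meson subsetD)
    qed (use that in blast)
    then show ?thesis using that by (auto simp: a_def)
  qed
  have a_else: "a x = A0" if "\<And>A. A \<in> \<alpha> \<Longrightarrow> x \<notin> S A" for x using that by (auto simp: a_def)
  define R where "R = space M - (\<Union>A\<in>\<alpha>. S A)"
  define NN where "NN = (\<Union>A\<in>\<alpha>. Nf A)"
  have NN: "NN \<in> null_sets M" unfolding NN_def using \<alpha>(1) S(2)
    by (intro null_sets_UN' countable_finite) auto
  have Rs: "R \<in> sets M" unfolding R_def using \<alpha>(1) S(1) by (intro sets.Diff sets.finite_UN) auto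
  \<comment> \<open>Almost every point lies in a member of \<open>\<alpha>\<close> and outside
    \<open>NN\<close>, hence in a core; so \<open>R\<close> is null.\<close>
  have "(\<Union>\<alpha>) \<in> sets (completion M)" using \<alpha>(1,2) by (intro sets.finite_Union) auto
  then have "AE x in completion M. x \<in> \<Union>\<alpha>" using \<alpha>(4) C.prob_eq_1 by blast
  then have "AE x in M. x \<in> \<Union>\<alpha>" by (simp add: AE_completion_iff)
  moreover have "AE x in M. x \<notin> NN" using NN by (rule AE_not_in)
  ultimately have "AE x in M. x \<notin> R"
    by eventually_elim (use S(4) in \<open>auto simp: R_def NN_def\<close>)
  then have "R \<in> null_sets M"
    using Rs AE_iff_null_sets[OF Rs] by blast
  then have N: "NN \<union> R \<in> null_sets M" using NN by auto
  show ?thesis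
  proof (rule that[OF N])
    show "a x \<in> \<alpha>" for x
      using a_eq a_else A0 by (cases "\<exists>A\<in>\<alpha>. x \<in> S A") auto
    show "{x \<in> space M. a x = A} \<in> sets M" if A: "A \<in> \<alpha>" for A
    proof -
      have "x \<in> (if A = A0 then S A \<union> R else S A) \<longleftrightarrow> a x = A" if x: "x \<in> space M" for x
      proof (cases "\<exists>A\<in>\<alpha>. x \<in> S A")
        case True
        then obtain A' where A': "A' \<in> \<alpha>" "x \<in> S A'" by blast
        then have "x \<notin> R" by (auto simp: R_def)
        moreover have "x \<in> S A \<longleftrightarrow> A' = A" using A A' S(3) un by (meson subsetD)
        ultimately show ?thesis using a_eq[OF A'] by auto
      next
        case False
        then have "x \<in> R" "x \<notin> S A" using x A by (auto simp: R_def)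
        then show ?thesis using a_else[of x] False by auto
      qed
      moreover have "(if A = A0 then S A \<union> R else S A) \<subseteq> space M"
        using sets.sets_into_space[OF S(1)[OF A]] sets.sets_into_space[OF Rs] by auto
      ultimately have "{x \<in> space M. a x = A} = (if A = A0 then S A \<union> R else S A)" by blast
      then show ?thesis using S(1)[OF A] Rs by auto
    qed
    show "x \<in> A \<longleftrightarrow> a x = A" if x: "x \<in> space M - (NN \<union> R)" and A: "A \<in> \<alpha>" for x A
    proof -
      obtain A' where A': "A' \<in> \<alpha>" "x \<in> S A'" using x by (auto simp: R_def)
      have "x \<in> A \<longleftrightarrow> A' = A" using A A' S(3) un by (meson subsetD)
      then show ?thesis using a_eq[OF A'] by simp
    qed
  qed
qed

text \<open>Off the null preimages of \<open>N\<close> the sets of the join are the cylinders of the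
  labelled process, so their measures agree.\<close>

lemma partition_entropy_pullback_join:
  assumes P: "finite_process M (\<lambda>i x. a (\<phi> (s i) x)) \<alpha>" and sp: "space M = UNIV"
    and disj: "disjoint \<alpha>" and N: "N \<in> null_sets M"
    and pre: "\<And>i. \<phi> (s i) -` N \<in> null_sets M"
    and a: "\<And>x A. x \<notin> N \<Longrightarrow> A \<in> \<alpha> \<Longrightarrow> x \<in> A \<longleftrightarrow> a x = A"
  shows "partition_entropy M (pullback_join \<phi> s \<alpha> n)
    = finite_process.block_entropy M (\<lambda>i x. a (\<phi> (s i) x)) \<alpha> n"
proof -
  interpret finite_process M "\<lambda>i x. a (\<phi> (s i) x)" \<alpha> by fact
  define W where "W = {1..n} \<rightarrow>\<^sub>E \<alpha>"
  define X where "X \<tau> = (\<Inter>i\<in>{1..n}. \<phi> (s i) -` \<tau> i)" for \<tau>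
  have meas: "measure (completion M) (X \<tau>) = prob (cyl n \<tau>)" if \<tau>: "\<tau> \<in> W" for \<tau>
  proof -
    define N' where "N' = (\<Union>i\<in>{1..n}. \<phi> (s i) -` N)"
    have N': "N' \<in> null_sets M" unfolding N'_def using pre
      by (intro null_sets_UN' countable_finite) auto
    have cyl: "cyl n \<tau> \<in> sets M" using \<tau> by (intro cyl_sets) (simp add: W_def)
    have iff: "x \<in> X \<tau> \<longleftrightarrow> x \<in> cyl n \<tau>" if "x \<notin> N'" for x
    proof -
      have "\<phi> (s i) x \<in> \<tau> i \<longleftrightarrow> a (\<phi> (s i) x) = \<tau> i" if "i \<in> {1..n}" for i
        using \<open>x \<notin> N'\<close> that PiE_mem[OF \<tau>[unfolded W_def] that] by (intro a) (auto simp: N'_def)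
      then show ?thesis by (auto simp: X_def cyl_def sp)
    qed
    have Xc: "X \<tau> \<in> sets (completion M)"
      by (rule sets_completionI[of _ "cyl n \<tau> - N'" "X \<tau> \<inter> N'" N'])
        (use iff N' cyl in auto)
    have "AE x in completion M. x \<notin> N'" by (intro AE_completion AE_not_in N')
    then have "measure (completion M) (X \<tau>) = measure (completion M) (cyl n \<tau>)"
      using Xc cyl by (intro measure_eq_AE) (auto elim!: eventually_mono simp: iff)
    then show ?thesis using cyl by simp
  qed
  have "partition_entropy M (pullback_join \<phi> s \<alpha> n)
    = - (\<Sum>A\<in>X ` W. measure (completion M) A * ln (measure (completion M) A))"
    by (simp add: partition_entropy_def pullback_join_def W_def X_def[abs_def])
  also have "(\<Sum>A\<in>X ` W. measure (completion M) A * ln (measure (completion M) A))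
    = (\<Sum>\<tau>\<in>W. measure (completion M) (X \<tau>) * ln (measure (completion M) (X \<tau>)))"
  \<comment> \<open>The join is a set of sets and may merge words; by disjointness this happens only
    for the empty set, whose summand is 0.\<close>
  proof (rule sum.reindex_nontrivial[unfolded comp_def])
    show "finite W" unfolding W_def by (rule finite_words)
    fix \<tau> \<tau>' assume \<tau>: "\<tau> \<in> W" "\<tau>' \<in> W" "\<tau> \<noteq> \<tau>'" "X \<tau> = X \<tau>'"
    then obtain i where i: "i \<in> {1..n}" "\<tau> i \<noteq> \<tau>' i"
      unfolding W_def by (meson PiE_ext)
    have "\<tau> i \<in> \<alpha>" "\<tau>' i \<in> \<alpha>" using \<tau> i(1) by (auto simp: W_def)
    then have "\<tau> i \<inter> \<tau>' i = {}" using disjointD[OF disj] i(2) by blast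
    then have "X \<tau> \<inter> X \<tau>' = {}" using i(1) unfolding X_def by blast
    then have "X \<tau> = {}" using \<tau>(4) by simp
    then show "measure (completion M) (X \<tau>) * ln (measure (completion M) (X \<tau>)) = 0" by simp
  qed
  also have "\<dots> = (\<Sum>\<tau>\<in>W. prob (cyl n \<tau>) * ln (prob (cyl n \<tau>)))" using meas by (intro sum.cong) auto
  finally show ?thesis by (simp add: block_entropy_def W_def)
qed

text \<open>If infinitely many increments exceeded \<open>c\<close>, a filter of such times with all
  limits would contradict \<open>eventually_increment_le\<close>; its hypothesis \<open>few\<close>
  holds because a failure would yield an essential IT tuple.\<close>

lemma sequence_entropy_le:
  fixes G :: "('g, 'm) monoid_scheme"
    and \<phi> :: "'g \<Rightarrow> 'x::metric_space \<Rightarrow> 'x"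
  assumes compact: "compact (UNIV :: 'x set)"
    and hom: "homeomorphic_action G \<phi>"
    and K: "K \<ge> 2"
    and noIT: "\<not> (\<exists>x. essential_tuple K x \<and> IT_tuple G \<phi> K x)"
    and M: "M \<in> invariant_measures G \<phi>"
    and \<alpha>: "\<alpha> \<in> measurable_partitions M"
    and s: "\<And>i. s i \<in> carrier G"
    and e: "e > 0"
  shows "sequence_entropy \<phi> M s \<alpha> \<le> ereal (ln (real K - 1) + e)"
proof -
  interpret prob_space M using M by (simp add: invariant_measures_def)
  have sb: "sets M = sets borel" using M by (simp add: invariant_measures_def)
  have sp: "space M = UNIV" using sets_eq_imp_space_eq[OF sb] by simp
  have pre: "\<phi> g -` E \<in> sets M" if "g \<in> carrier G" "E \<in> sets M" for g E
  proof -
    have "continuous_on UNIV (\<phi> g)"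
      using hom that(1) homeomorphic_imp_continuous_map
      unfolding homeomorphic_action_def by fastforce
    then have "\<phi> g \<in> borel_measurable borel" by (rule borel_measurable_continuous_onI)
    from measurable_sets[OF this, of E] show ?thesis using that(2) by (simp add: sb)
  qed
  have inv: "emeasure M (\<phi> g -` E) = emeasure M E" if "g \<in> carrier G" "E \<in> sets M" for g E
    using M that by (simp add: invariant_measures_def sb)
  have invm: "prob (\<phi> g -` E) = prob E" if "g \<in> carrier G" "E \<in> sets M" for g E
    using inv[OF that] by (simp add: measure_def)
  obtain a N where N: "N \<in> null_sets M" and a: "\<And>x. a x \<in> \<alpha>"
    "\<And>A. A \<in> \<alpha> \<Longrightarrow> {x \<in> space M. a x = A} \<in> sets M"
    "\<And>x A. x \<in> space M - N \<Longrightarrow> A \<in> \<alpha> \<Longrightarrow> x \<in> A \<longleftrightarrow> a x = A"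
    by (rule measurable_partition_labelling[OF prob_space_axioms \<alpha>]) blast
  \<comment> \<open>The fibres of the label lie in \<open>sets M\<close> and are disjoint
    everywhere; they replace the members of \<open>\<alpha>\<close>.\<close>
  define D where "D A = {x. a x = A}" for A
  have D: "D A \<in> sets M" if "A \<in> \<alpha>" for A using a(2)[OF that] by (simp add: D_def sp)
  have fib: "{x \<in> space M. a (\<phi> (s i) x) = A} = \<phi> (s i) -` D A" for i A by (auto simp: D_def sp)
  interpret finite_process M "\<lambda>i x. a (\<phi> (s i) x)" \<alpha>
    using \<alpha> a(1) pre[OF s D] by unfold_locales (auto simp: measurable_partitions_def fib)
  have H: "partition_entropy M (pullback_join \<phi> s \<alpha> n) = block_entropy n" for n
  proof (rule partition_entropy_pullback_join[where a = a and \<phi> = \<phi> and s = s, OF finite_process_axioms sp _ N])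
    show "disjoint \<alpha>" using \<alpha> by (simp add: measurable_partitions_def)
    show "\<phi> (s i) -` N \<in> null_sets M" for i
      using N pre[OF s] inv[OF s] by (auto simp: null_sets_def)
  qed (use a(3) in \<open>simp add: sp\<close>)
  define c where "c = ln (real K - 1) + e"
  have "eventually (\<lambda>n. block_entropy (Suc n) \<le> block_entropy n + c) sequentially"
  proof (rule ccontr)
    assume neg: "\<not> ?thesis"
    define F0 where "F0 = inf sequentially (principal {n. \<not> block_entropy (Suc n) \<le> block_entropy n + c})"
    have "F0 \<noteq> bot"
    proof
      assume "F0 = bot"
      then have "eventually (\<lambda>_. False) F0" by simp
      then show False using neg by (simp add: F0_def eventually_inf_principal)
    qed
    \<comment> \<open>The coordinates are all pairs of sets, as \<open>prob\<close> takes values in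
      \<open>{0..1}\<close> on every set. The shift to \<open>Suc i\<close> matches the symbol added
      between \<open>block_entropy i\<close> and \<open>block_entropy (Suc i)\<close>.\<close>
    obtain F l where F: "F \<noteq> bot" "F \<le> F0"
      and l: "\<And>p. ((\<lambda>i. prob (fst p \<inter> \<phi> (s (Suc i)) -` snd p)) \<longlongrightarrow> l p) F"
      by (rule cluster_filter[of F0 "\<lambda>i p. prob (fst p \<inter> \<phi> (s (Suc i)) -` snd p)"])
        (use \<open>F0 \<noteq> bot\<close> in auto)
    define \<nu> where "\<nu> W E = l (W, E)" for W E
    have \<nu>: "((\<lambda>i. prob (W \<inter> \<phi> (s (Suc i)) -` E)) \<longlongrightarrow> \<nu> W E) F" for W E
      using l[of "(W, E)"] by (simp add: \<nu>_def)
    have "eventually (\<lambda>i. block_entropy (Suc i) \<le> block_entropy i + (ln (real (K - 1)) + e)) F"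
    proof (rule eventually_increment_le[where \<nu> = "\<lambda>W A. \<nu> W (D A)"])
      show "F \<le> sequentially" using F(2) unfolding F0_def by simp
      show "((\<lambda>i. prob (W \<inter> {x \<in> space M. a (\<phi> (s (Suc i)) x) = A})) \<longlongrightarrow> \<nu> W (D A)) F" for W A
        unfolding fib by (rule \<nu>)
      fix S B assume S: "S \<subseteq> \<alpha>" "K - 1 < card S" and B: "B \<in> events" "0 < prob B"
      show "\<exists>W A. W \<in> events \<and> W \<subseteq> B \<and> 0 < prob W \<and> A \<in> S \<and> \<nu> W (D A) \<le> 0"
      proof (rule ccontr)
        assume no: "\<not> ?thesis"
        \<comment> \<open>Any \<open>K\<close> atoms from \<open>S\<close>, numbered by
          \<open>h\<close>, satisfy together with \<open>B\<close> the hypotheses of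
          \<open>essential_IT_tuple_exists\<close>.\<close>
        have "K \<le> card S" using S(2) by simp
        then obtain T where T: "T \<subseteq> S" "card T = K" "finite T" by (rule obtain_subset_with_card_n)
        then obtain h where h: "bij_betw h {1..K} T" using ex_bij_betw_nat_finite_1 by metis
        have hS: "h k \<in> S" if "k \<in> {1..K}" for k using bij_betwE[OF h] that T(1) by blast
        have "\<exists>x. essential_tuple K x \<and> IT_tuple G \<phi> K x"
        proof (rule essential_IT_tuple_exists[where A = "\<lambda>k. D (h k)" and s = "\<lambda>i. s (Suc i)"])
          show "D (h k) \<in> sets M" if "k \<in> {1..K}" for k using D hS[OF that] S(1) by blast
          show "D (h k) \<inter> D (h j) = {}" if "k \<in> {1..K}" "j \<in> {1..K}" "k \<noteq> j" for k j
          proof -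
            have "h k \<noteq> h j" using inj_onD[OF bij_betw_imp_inj_on[OF h] _ that(1,2)] that(3) by blast
            then show ?thesis by (auto simp: D_def)
          qed
          show "\<nu> W (D (h k)) > 0" if "W \<in> sets M" "W \<subseteq> B" "0 < prob W" "k \<in> {1..K}" for W k
          proof (rule ccontr)
            assume "\<not> ?thesis"
            then have "\<nu> W (D (h k)) \<le> 0" by simp
            then show False using no that(1-3) hS[OF that(4)] by blast
          qed
        qed (use compact sb F(1) K pre invm s \<nu> B finite_measure_axioms in auto)
        then show False using noIT by blast
      qed
    qed (use F(1) K e in auto)
    moreover have "eventually (\<lambda>i. \<not> block_entropy (Suc i) \<le> block_entropy i + c) F"
      by (rule filter_leD[OF F(2)]) (simp add: F0_def eventually_inf_principal)
    ultimately have "eventually (\<lambda>_. False) F"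
      by eventually_elim (use K in \<open>simp add: c_def of_nat_diff\<close>)
    then show False using F(1) by simp
  qed
  then have "limsup (\<lambda>n. ereal (1 / real n * block_entropy n)) \<le> ereal c"
    by (rule limsup_le_of_increments)
  then show ?thesis by (simp add: sequence_entropy_def H c_def)
qed

theorem corollary1p5:
  fixes G :: "('g, 'm) monoid_scheme"
    and \<phi> :: "'g \<Rightarrow> 'x::metric_space \<Rightarrow> 'x"
    and K :: nat
  assumes "compact (UNIV :: 'x set)"
    and "group G" and "countable (carrier G)" and "infinite (carrier G)"
    and "homeomorphic_action G \<phi>"
    and "K \<ge> 2"
    and "\<not> (\<exists>x. essential_tuple K x \<and> IT_tuple G \<phi> K x)"
  shows "\<forall>\<mu>\<in>invariant_measures G \<phi>. max_sequence_entropy G \<phi> \<mu> \<le> ereal (ln (real K - 1))"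
proof
  fix \<mu> assume \<mu>: "\<mu> \<in> invariant_measures G \<phi>"
  have "sequence_entropy \<phi> \<mu> s \<alpha> \<le> ereal (ln (real K - 1))"
    if \<alpha>: "\<alpha> \<in> measurable_partitions \<mu>" and s: "range s \<subseteq> carrier G" for \<alpha> s
  proof (rule ereal_le_epsilon2)
    \<comment> \<open>The slack \<open>e\<close> absorbed the approximation errors and is removed
      here.\<close>
    fix e :: real assume "0 < e"
    then have "sequence_entropy \<phi> \<mu> s \<alpha> \<le> ereal (ln (real K - 1) + e)"
      using s by (intro sequence_entropy_le[OF assms(1,5,6,7) \<mu> \<alpha>]) auto
    then show "sequence_entropy \<phi> \<mu> s \<alpha> \<le> ereal (ln (real K - 1)) + ereal e" by simp
  qed
  then show "max_sequence_entropy G \<phi> \<mu> \<le> ereal (ln (real K - 1))"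
    unfolding max_sequence_entropy_def max_sequence_entropy_of_def by (intro SUP_least) auto
qed

end
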